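(* Let $a_1,\dots,a_n$ be arbitrary nonzero real numbers. The following two assertions are equivalent. (i) For every integer valued function $f:\mathbb{R}\to\mathbb{Z}$: if $f$ can be decomposed as $f=f_1+\cdots+f_n$ such that each $f_j$ is an $a_j$-periodic measurable function $\mathbb{R}\to\mathbb{R}$, then $f$ can also be decomposed as $f=g_1+\cdots+g_n$ such that each $g_j$ is an $a_j$-periodic integer valued measurable function on $\mathbb{R}$. (ii) If $B_1,\dots,B_N$ are the equivalence classes of $\{a_1,\dots,a_n\}$ with respect to the relation $a\sim b\Leftrightarrow a/b\in\mathbb{Q}$, and $b_j$ denotes the least common multiple of the numbers in $B_j$ ($j=1,\dots,N$), then $\frac{1}{b_1},\dots,\frac{1}{b_N}$ are linearly independent over $\mathbb{Q}$.
   Context: A function $h$ on $\mathbb{R}$ is $a$-periodic if $h(x+a)=h(x)$ for all $x\in\mathbb{R}$. Measurable means Lebesgue measurable, and the decompositions are equalities at every point of $\mathbb{R}$. The least common multiple of nonzero real numbers $c_1,\dots,c_m$ with pairwise rational ratios is the generator, unique up to sign, of the (nontrivial) cyclic group $c_1\mathbb{Z}\cap\cdots\cap c_m\mathbb{Z}$; the choice of sign is irrelevant. *)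

theory Defs
  imports "HOL-Analysis.Analysis" "HOL-Library.Periodic_Fun"
begin

definition commensurability_rel :: "real set \<Rightarrow> (real \<times> real) set" where
  "commensurability_rel A = {(x, y). x \<in> A \<and> y \<in> A \<and> x / y \<in> \<rat>}"

definition int_multiples :: "real \<Rightarrow> real set" where
  "int_multiples c = range (\<lambda>k::int. of_int k * c)"

text \<open>
  The generator of the intersection is only determined up to sign; the positive one is chosen here.
  It exists uniquely for finite nonempty sets of nonzero, pairwise commensurable reals
  (lemma \<open>real_lcm_ex1\<close> below); for other sets the value is unspecified.
\<close>
definition real_lcm :: "real set \<Rightarrow> real" where
  "real_lcm B = (THE b. b > 0 \<and> (\<Inter>c\<in>B. int_multiples c) = int_multiples b)"

text \<open>
  Linear independence over \<open>\<rat>\<close> of a family of reals, as opposed to that of the set of its values: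
  injectivity rules out repetitions.
\<close>
definition rat_independent_family :: "('i \<Rightarrow> real) \<Rightarrow> 'i set \<Rightarrow> bool" where
  "rat_independent_family v I \<longleftrightarrow>
     inj_on v I \<and> module.independent (\<lambda>(q::rat) x. of_rat q * x) (v ` I)"

lemma equiv_commensurability_rel:
  assumes "0 \<notin> A"
  shows "equiv A (commensurability_rel A)"
proof (rule equivI)
  show "commensurability_rel A \<subseteq> A \<times> A"
    by (auto simp: commensurability_rel_def)
  show "refl_on A (commensurability_rel A)"
    using assms by (auto simp: refl_on_def commensurability_rel_def)
  have "y / x \<in> \<rat>" if "x / y \<in> \<rat>" for x y :: real
    using Rats_inverse[OF that] by simp
  then show "sym (commensurability_rel A)"
    by (auto simp: sym_def commensurability_rel_def)
  have "x / z \<in> \<rat>" if "x / y \<in> \<rat>" "y / z \<in> \<rat>" "y \<in> A" for x y z :: real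
  proof -
    have "x / z = (x / y) * (y / z)" using assms that by auto
    then show ?thesis using that Rats_mult by metis
  qed
  then show "trans (commensurability_rel A)"
    by (auto simp: trans_def commensurability_rel_def)
qed

lemma real_lcm_ex1:
  assumes fin: "finite B" and ne: "B \<noteq> {}" and nz: "0 \<notin> B"
    and comm: "\<And>c d. c \<in> B \<Longrightarrow> d \<in> B \<Longrightarrow> c / d \<in> \<rat>"
  shows "\<exists>!b. b > 0 \<and> (\<Inter>c\<in>B. int_multiples c) = int_multiples b"
proof -
  define G where "G = (\<Inter>c\<in>B. int_multiples c)"
  obtain c where c: "c \<in> B" using ne by blast
  then have c0: "c \<noteq> 0" using nz by blast
  have GD: "\<exists>k::int. x = of_int k * d" if "x \<in> G" "d \<in> B" for x d
    using that unfolding G_def int_multiples_def by blast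
  have diff: "x - y \<in> G" if "x \<in> G" "y \<in> G" for x y
    unfolding G_def
  proof
    fix d assume "d \<in> B"
    with that obtain k l :: int where "x = of_int k * d" "y = of_int l * d"
      using GD by metis
    then have "x - y = of_int (k - l) * d" by (simp add: algebra_simps)
    then show "x - y \<in> int_multiples d" unfolding int_multiples_def by blast
  qed
  have mult: "of_int m * x \<in> G" if "x \<in> G" for x and m :: int
    unfolding G_def
  proof
    fix d assume "d \<in> B"
    with that obtain k :: int where "x = of_int k * d"
      using GD by metis
    then have "of_int m * x = of_int (m * k) * d" by simp
    then show "of_int m * x \<in> int_multiples d" unfolding int_multiples_def by blast
  qed
  have "\<exists>q::int. q \<noteq> 0 \<and> of_int q * c \<in> int_multiples d" if d: "d \<in> B" for d
  proof -
    have "c / d \<in> \<rat>" "d \<noteq> 0" using comm c d nz by auto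
    then obtain p q :: int where "q > 0" "c / d = of_int p / of_int q"
      by (metis Rats_cases')
    then have "q \<noteq> 0" "of_int q * c = of_int p * d"
      using \<open>d \<noteq> 0\<close> by (auto simp: field_simps)
    then show ?thesis unfolding int_multiples_def by blast
  qed
  then obtain q :: "real \<Rightarrow> int"
    where q: "\<And>d. d \<in> B \<Longrightarrow> q d \<noteq> 0" "\<And>d. d \<in> B \<Longrightarrow> of_int (q d) * c \<in> int_multiples d"
    by metis
  define M where "M = (\<Prod>d\<in>B. q d)"
  have M0: "M \<noteq> 0" using q fin by (simp add: M_def)
  have MG: "of_int M * c \<in> G"
    unfolding G_def
  proof
    fix d assume d: "d \<in> B"
    then obtain k where k: "of_int (q d) * c = of_int k * d"
      using q(2) unfolding int_multiples_def by blast
    have "M = prod q (B - {d}) * q d"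
      using d fin by (simp add: M_def prod.remove mult.commute)
    then have "of_int M * c = of_int (prod q (B - {d}) * k) * d"
      by (metis k mult.assoc of_int_mult)
    then show "of_int M * c \<in> int_multiples d" unfolding int_multiples_def by blast
  qed
  have absG: "\<bar>x\<bar> \<in> G" if "x \<in> G" for x
    using mult[OF that, of "-1"] that by (cases "x \<ge> 0") auto
  define P where "P k \<longleftrightarrow> k > 0 \<and> real k * \<bar>c\<bar> \<in> G" for k
  have "P (nat \<bar>M\<bar>)"
    using absG[OF MG] M0 by (simp add: P_def abs_mult)
  define k0 where "k0 = (LEAST k. P k)"
  have k0: "P k0" unfolding k0_def using \<open>P (nat \<bar>M\<bar>)\<close> by (rule LeastI)
  define b where "b = real k0 * \<bar>c\<bar>"
  have b: "b > 0" "b \<in> G" using k0 c0 by (auto simp: P_def b_def)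
  have "G = int_multiples b"
  proof
    show "int_multiples b \<subseteq> G" using mult b by (auto simp: int_multiples_def)
    show "G \<subseteq> int_multiples b"
    proof
      fix x assume x: "x \<in> G"
      then obtain m :: int where "x = of_int m * c"
        using c GD by metis
      then obtain m :: int where m: "x = of_int m * \<bar>c\<bar>"
        by (cases "c \<ge> 0") (auto intro: that[of m] that[of "-m"])
      define r where "r = m mod int k0"
      have r: "0 \<le> r" "r < int k0" using k0 by (auto simp: r_def P_def)
      have me: "m = r + (m div int k0) * int k0" by (simp add: r_def)
      have "of_int r * \<bar>c\<bar> = x - of_int (m div int k0) * b"
      proof -
        have "real_of_int m = of_int r + of_int (m div int k0) * real k0"
          by (metis me of_int_add of_int_mult of_int_of_nat_eq)
        then show ?thesis unfolding m b_def by (simp add: algebra_simps)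
      qed
      then have "of_int r * \<bar>c\<bar> \<in> G" using diff x mult b by metis
      moreover have "\<not> P (nat r)"
        using not_less_Least[of "nat r" P] r unfolding k0_def[symmetric] by simp
      ultimately have "r = 0"
        using r unfolding P_def by (cases "r = 0") auto
      then have "x = of_int (m div int k0) * b"
        using me unfolding m b_def
        by (metis (no_types) add_0 mult.assoc of_int_mult of_int_of_nat_eq)
      then show "x \<in> int_multiples b" unfolding int_multiples_def by blast
    qed
  qed
  moreover have "b' = b" if b': "b' > 0" "int_multiples b' = int_multiples b" for b'
  proof -
    have self: "x \<in> int_multiples x" for x
      unfolding int_multiples_def by (rule image_eqI[of _ _ 1]) auto
    obtain k l :: int where kl: "b' = of_int k * b" "b = of_int l * b'"
      using self[of b] self[of b'] b'(2) unfolding int_multiples_def by blast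
    have "k > 0" using kl(1) b(1) b'(1) by (metis of_int_0_less_iff zero_less_mult_pos2)
    moreover have "l > 0" using kl(2) b(1) b'(1) by (metis of_int_0_less_iff zero_less_mult_pos2)
    ultimately have "1 \<le> real_of_int k" "1 \<le> real_of_int l" by linarith+
    then have "1 * b \<le> of_int k * b" "1 * b' \<le> of_int l * b'"
      using b(1) b'(1) by (intro mult_right_mono; simp)+
    then have "b \<le> b'" "b' \<le> b"
      unfolding kl(1)[symmetric] kl(2)[symmetric] by simp_all
    then show ?thesis by simp
  qed
  ultimately show ?thesis using b unfolding G_def by (intro ex1I[of _ b]) auto
qed

lemma vector_space_rat_real: "vector_space (\<lambda>(q::rat) (x::real). of_rat q * x)"
  by unfold_locales (simp_all add: algebra_simps of_rat_add of_rat_mult)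

lemma rat_independent_family_iff:
  assumes "finite I"
  shows "rat_independent_family v I \<longleftrightarrow>
    (\<forall>q::'i \<Rightarrow> rat. (\<Sum>i\<in>I. of_rat (q i) * v i) = 0 \<longrightarrow> (\<forall>i\<in>I. q i = 0))"
proof -
  interpret vector_space "\<lambda>(q::rat) (x::real). of_rat q * x"
    by (rule vector_space_rat_real)
  have fin: "finite (v ` I)" using assms by simp
  show ?thesis
  proof
    assume "rat_independent_family v I"
    then have inj: "inj_on v I" and ind: "independent (v ` I)"
      by (auto simp: rat_independent_family_def)
    show "\<forall>q. (\<Sum>i\<in>I. of_rat (q i) * v i) = 0 \<longrightarrow> (\<forall>i\<in>I. q i = 0)"
    proof (intro allI impI ballI)
      fix q :: "'i \<Rightarrow> rat" and i assume s: "(\<Sum>i\<in>I. of_rat (q i) * v i) = 0" and i: "i \<in> I"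
      have "(\<Sum>x\<in>v ` I. of_rat (q (inv_into I v x)) * x) = (\<Sum>i\<in>I. of_rat (q i) * v i)"
        using inj by (simp add: sum.reindex)
      then show "q i = 0"
        using independentD[OF ind fin, of "\<lambda>x. q (inv_into I v x)" "v i"] s i inj by simp
    qed
  next
    assume R: "\<forall>q::'i \<Rightarrow> rat. (\<Sum>i\<in>I. of_rat (q i) * v i) = 0 \<longrightarrow> (\<forall>i\<in>I. q i = 0)"
    have inj: "inj_on v I"
    proof (rule inj_onI, rule ccontr)
      fix i j assume ij: "i \<in> I" "j \<in> I" "v i = v j" "i \<noteq> j"
      define q :: "'i \<Rightarrow> rat" where "q = (\<lambda>k. if k = i then 1 else if k = j then -1 else 0)"
      have "(\<Sum>k\<in>I. of_rat (q k) * v k) = (\<Sum>k\<in>{i, j}. of_rat (q k) * v k)"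
        using assms ij by (intro sum.mono_neutral_right) (auto simp: q_def)
      also have "\<dots> = 0" using ij by (simp add: q_def)
      finally have "q i = 0" using R ij by blast
      then show False by (simp add: q_def)
    qed
    have "u x = 0" if s: "(\<Sum>x\<in>v ` I. of_rat (u x) * x) = 0" and x: "x \<in> v ` I" for u x
      using R[rule_format, of "u \<circ> v"] s x inj by (auto simp: sum.reindex)
    then have "independent (v ` I)" by (auto simp: dependent_finite[OF fin])
    with inj show "rat_independent_family v I" by (simp add: rat_independent_family_def)
  qed
qed

end

theory Submission
  imports Defs "HOL-Number_Theory.Cong" "HOL-Computational_Algebra.Computational_Algebra"
begin

text \<open>
  Over one class \<open>B\<close> of commensurable periods the problem lives on \<open>\<int>\<close>. There are commuting retractions
  \<open>t m\<close> of \<open>\<int>\<close> onto representatives modulo the periods \<open>m\<close>, so for a sum of \<open>m\<close>-periodic functions the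
  product of the operators \<open>1 - Q m\<close>, \<open>Q m F = F \<circ> t m\<close>, vanishes; expanding it gives a decomposition whose
  summands are as integral and as measurable as \<open>F\<close> itself. For several classes, the functions decomposable over
  one class are the kernel of a shift polynomial in \<open>\<int>[x]\<close> with unit leading and constant coefficients
  (the gcd of \<open>x^L - 1\<close> and \<open>\<Prod>(x^m - 1)\<close>). Such a polynomial acts surjectively on the integer valued functions
  that are periodic in an incommensurable direction, and induction on the classes yields an integer valued
  decomposition from a real valued one, without measurability and without any condition on the periods.

  If the \<open>1 / b\<close> are independent, Kronecker's theorem and the continuity of translations in \<open>L\<^sup>1\<close> show that the class
  sums of a measurable decomposition are a.e. constant modulo 1. Subtracting the constants makes them
  integer valued off a translation invariant null set, on which the algebraic decomposition is used instead.
  Conversely, from \<open>\<Sum> m / r = 0\<close> the integer valued function \<open>\<Sum> frac (m x / r)\<close> has no integer valued measurable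
  decomposition, because a measurable decomposition of \<open>0\<close> into incommensurable periods is a.e. constant.
\<close>

section \<open>Commensurable periods\<close>

text \<open>Plain reductions modulo different numbers do not commute, for example those modulo 2 and
  modulo 3. Reductions modulo powers of one prime do, because these powers form a chain under
  divisibility. The Chinese remainder theorem assembles \<open>t m\<close> from the reductions
  modulo the prime power parts of m.\<close>

lemma commuting_retractions:
  fixes M :: "nat set"
  assumes fin: "finite M" and nz: "0 \<notin> M"
  obtains t :: "nat \<Rightarrow> int \<Rightarrow> int"
  where "\<And>m k. m \<in> M \<Longrightarrow> int m dvd t m k - k"
    and "\<And>m k. m \<in> M \<Longrightarrow> t m (k + int m) = t m k"
    and "\<And>m m' k. m \<in> M \<Longrightarrow> m' \<in> M \<Longrightarrow> t m (t m' k) = t m' (t m k)"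
proof -
  define L where "L = \<Prod>M"
  have L: "L \<noteq> 0" using fin nz by (auto simp: L_def)
  have dvdL: "m dvd L" if "m \<in> M" for m
    using that fin by (auto simp: L_def intro: dvd_prodI)
  define q where "q p = p ^ multiplicity p L" for p
  define v where "v p m = p ^ multiplicity p m" for p m :: nat
  define PF where "PF = prime_factors L"
  have pr: "prime p" "p > 0" if "p \<in> PF" for p using that by (auto simp: PF_def intro: prime_gt_0_nat)
  have cop: "coprime (q p) (q p')" if "p \<in> PF" "p' \<in> PF" "p \<noteq> p'" for p p'
    using that pr unfolding q_def by (simp add: primes_coprime)
  \<comment> \<open>The bound \<open>prod q PF\<close>, which is L written as a product of prime
    powers, singles out one solution of the congruences.\<close>
  define S where "S u x \<longleftrightarrow> x < prod q PF \<and> (\<forall>p\<in>PF. [x = u p] (mod q p))" for u x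
  have ex1: "\<exists>!x. S u x" for u
    unfolding S_def
    by (rule chinese_remainder_unique_nat) (use cop pr in \<open>auto simp: PF_def q_def\<close>)
  define t where "t m k = int (THE x. S (\<lambda>p. nat (k mod int (v p m))) x)" for m k
  have tS: "S (\<lambda>p. nat (k mod int (v p m))) (nat (t m k))" for m k
    unfolding t_def using theI'[OF ex1] by simp
  have t0: "t m k \<ge> 0" for m k by (simp add: t_def)
  have v_dvd: "v p m dvd q p" if "p \<in> PF" "m \<in> M" for p m
    unfolding v_def q_def using dvdL[OF that(2)] L pr[OF that(1)]
    by (intro le_imp_power_dvd dvd_imp_multiplicity_le) auto
  have vpos: "v p m > 0" if "p \<in> PF" for p m using pr[OF that] by (simp add: v_def)
  have tcong: "[t m k = k mod int (v p m)] (mod int (q p))" if "p \<in> PF" for p m k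
  proof -
    have "[nat (t m k) = nat (k mod int (v p m))] (mod q p)"
      using tS[of k m] that by (auto simp: S_def)
    then show ?thesis
      using t0[of m k] vpos[OF that, of m] by (metis cong_int_iff int_nat_eq of_nat_0_less_iff pos_mod_sign)
  qed
  have t_dvd: "int m dvd t m k - k" if m: "m \<in> M" for m k
  proof (cases "t m k = k")
    case False
    have "m \<noteq> 0" using m nz by metis
    \<comment> \<open>Divisibility is checked prime by prime. The case \<open>t m k = k\<close> is
      split off because the multiplicity in 0 is 0 by convention.\<close>
    have "m dvd nat \<bar>t m k - k\<bar>"
    proof (rule multiplicity_le_imp_dvd[OF \<open>m \<noteq> 0\<close>])
      fix p :: nat assume p: "prime p"
      show "multiplicity p m \<le> multiplicity p (nat \<bar>t m k - k\<bar>)"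
      proof (cases "p dvd m")
        case True
        then have P: "p \<in> PF" using dvdL[OF m] L p by (auto simp: PF_def prime_factors_dvd)
        have "[t m k = k mod int (v p m)] (mod int (v p m))"
          using tcong[OF P] v_dvd[OF P m] by (meson cong_dvd_modulus int_dvd_int_iff)
        then have "int (v p m) dvd t m k - k"
          by (metis cong_iff_dvd_diff cong_mod_right)
        then have "v p m dvd nat \<bar>t m k - k\<bar>" by (simp add: nat_abs_dvd_iff flip: dvd_nat_abs_iff)
        then show ?thesis unfolding v_def using False p
          by (intro multiplicity_geI) auto
      qed (simp add: not_dvd_imp_multiplicity_0)
    qed
    then show ?thesis by simp
  qed simp
  have t_per: "t m (k + int m) = t m k" for m k
  proof -
    have "int (v p m) dvd int m" for p unfolding v_def int_dvd_int_iff by (rule multiplicity_dvd)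
    then have "(k + int m) mod int (v p m) = k mod int (v p m)" for p
      by (metis dvd_eq_mod_eq_0 add.right_neutral mod_add_right_eq)
    then show ?thesis by (simp add: t_def)
  qed
  \<comment> \<open>Reducing modulo p^j and then modulo p^i is reduction modulo p^min(i, j). So the
    composition solves a system of congruences that is symmetric in m and m', and uniqueness of the
    solution gives \<open>comm\<close>.\<close>
  have tt: "S (\<lambda>p. nat (k mod int (p ^ min (multiplicity p m) (multiplicity p m')))) (nat (t m (t m' k)))"
    if m: "m \<in> M" "m' \<in> M" for m m' k
  proof -
    have "t m' k mod int (v p m) = k mod int (p ^ min (multiplicity p m) (multiplicity p m'))"
      if p: "p \<in> PF" for p
    proof -
      have "[t m' k = k mod int (v p m')] (mod int (v p m))"
        using tcong[OF p] v_dvd[OF p m(1)] by (meson cong_dvd_modulus int_dvd_int_iff)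
      then have "t m' k mod int (v p m) = (k mod int (v p m')) mod int (v p m)"
        by (simp add: cong_def)
      also have "\<dots> = k mod int (p ^ min (multiplicity p m) (multiplicity p m'))"
      proof (cases "multiplicity p m \<le> multiplicity p m'")
        case True
        then have "v p m dvd v p m'" by (simp add: v_def le_imp_power_dvd)
        then show ?thesis using True by (simp add: v_def mod_mod_cancel min_def flip: of_nat_power)
      next
        case False
        then have "v p m' \<le> v p m" using pr[OF p] by (simp add: v_def power_increasing)
        moreover have "0 \<le> k mod int (v p m')" "k mod int (v p m') < int (v p m')"
          using vpos[OF p, of m'] by auto
        ultimately have "(k mod int (v p m')) mod int (v p m) = k mod int (v p m')"
          by (intro mod_pos_pos_trivial) linarith+
        then show ?thesis using False by (simp add: v_def min_def)
      qed
      finally show ?thesis .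
    qed
    then show ?thesis using tS[of "t m' k" m] by (simp add: S_def)
  qed
  have comm: "t m (t m' k) = t m' (t m k)" if "m \<in> M" "m' \<in> M" for m m' k
  proof -
    have "nat (t m (t m' k)) = nat (t m' (t m k))"
      using ex1 tt[OF that, of k] tt[OF that(2,1), of k, unfolded min.commute[of "multiplicity _ m'"]] by blast
    then show ?thesis using t0 by (metis int_nat_eq)
  qed
  show thesis using that[of t] t_dvd t_per comm by blast
qed

section \<open>Sums of periodic functions over a set of periods\<close>

definition periodic :: "real \<Rightarrow> (real \<Rightarrow> real) \<Rightarrow> bool" where
  "periodic c F \<longleftrightarrow> (\<forall>x. F (x + c) = F x)"

text \<open>The class \<open>S\<close> is a parameter so that one notion covers arbitrary,
  measurable, integer valued, and measurable integer valued decompositions.\<close>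

definition periodic_sums :: "real set \<Rightarrow> (real \<Rightarrow> real) set \<Rightarrow> (real \<Rightarrow> real) set" where
  "periodic_sums B S = {F. \<exists>h. (\<forall>c\<in>B. periodic c (h c) \<and> h c \<in> S) \<and> F = (\<lambda>x. \<Sum>c\<in>B. h c x)}"

lemma periodic_sumsI:
  "(\<And>c. c \<in> B \<Longrightarrow> periodic c (h c)) \<Longrightarrow> (\<And>c. c \<in> B \<Longrightarrow> h c \<in> S) \<Longrightarrow>
    (\<And>x. F x = (\<Sum>c\<in>B. h c x)) \<Longrightarrow> F \<in> periodic_sums B S"
  unfolding periodic_sums_def by (auto intro!: exI[of _ h])

lemma periodic_sumsE:
  assumes "F \<in> periodic_sums B S"
  obtains h where "\<And>c. c \<in> B \<Longrightarrow> periodic c (h c)" "\<And>c. c \<in> B \<Longrightarrow> h c \<in> S"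
    "\<And>x. F x = (\<Sum>c\<in>B. h c x)"
  using assms that unfolding periodic_sums_def by blast

lemma periodic_of_nat: "periodic c F \<Longrightarrow> F (x + real k * c) = F x"
proof (induction k)
  case (Suc k)
  have "F (x + real (Suc k) * c) = F ((x + real k * c) + c)" by (simp add: algebra_simps)
  then show ?case using Suc by (simp add: periodic_def)
qed simp

lemma periodic_of_int: "periodic c F \<Longrightarrow> F (x + of_int k * c) = F x"
proof (cases "k \<ge> 0")
  case True
  assume "periodic c F"
  then show ?thesis using periodic_of_nat[of c F x "nat k"] True by simp
next
  case False
  assume "periodic c F"
  then show ?thesis using periodic_of_nat[of c F "x + of_int k * c" "nat (-k)"] False by simp
qed

lemma periodic_abs: "periodic \<bar>c\<bar> F \<longleftrightarrow> periodic c F"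
  using periodic_of_int[of c F _ "-1"] periodic_of_int[of "-c" F _ "-1"]
  by (cases "c \<ge> 0") (auto simp: periodic_def)

text \<open>In F - F o \<tau> c the summand of c cancels, since \<open>\<tau> c\<close> leaves
  \<open>h c\<close> unchanged; commutation keeps the other differences invariant under their own
  retractions. The induction hypothesis splits this difference, and F o \<tau> c is the summand for
  c. All summands are built from F alone, so they inherit its regularity even if the given
  \<open>h\<close> has none.\<close>

lemma retraction_decomposition:
  fixes F :: "'x \<Rightarrow> 'a::ab_group_add"
  assumes "finite B" "F \<in> S"
    and "\<And>b b' x. b \<in> B \<Longrightarrow> b' \<in> B \<Longrightarrow> \<tau> b (\<tau> b' x) = \<tau> b' (\<tau> b x)"
    and "\<And>b x. b \<in> B \<Longrightarrow> h b (\<tau> b x) = h b x"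
    and "\<And>x. F x = (\<Sum>b\<in>B. h b x)"
    and S_diff: "\<And>F G. F \<in> S \<Longrightarrow> G \<in> S \<Longrightarrow> (\<lambda>x. F x - G x) \<in> S"
    and "\<And>F b. b \<in> B \<Longrightarrow> F \<in> S \<Longrightarrow> (\<lambda>x. F (\<tau> b x)) \<in> S"
  shows "\<exists>g. (\<forall>b\<in>B. g b \<in> S) \<and> (\<forall>x. F x = (\<Sum>b\<in>B. g b (\<tau> b x)))"
  using assms(1-5,7)
proof (induction B arbitrary: F h)
  case (insert c B)
  define h' where "h' b x = h b x - h b (\<tau> c x)" for b x
  have 1: "(\<lambda>x. F x - F (\<tau> c x)) \<in> S" using insert.prems(1,5) S_diff by simp
  have 2: "h' b (\<tau> b x) = h' b x" if "b \<in> B" for b x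
    using insert.prems(2,3) that by (simp add: h'_def)
  have 3: "F x - F (\<tau> c x) = (\<Sum>b\<in>B. h' b x)" for x
    using insert.hyps insert.prems(3,4) by (simp add: h'_def sum_subtractf)
  obtain g where g: "\<forall>b\<in>B. g b \<in> S" "\<forall>x. F x - F (\<tau> c x) = (\<Sum>b\<in>B. g b (\<tau> b x))"
    using insert.IH[OF 1 insert.prems(2) 2 3 insert.prems(5)] by auto
  have "F x = (\<Sum>b\<in>insert c B. (g(c := F)) b (\<tau> b x))" for x
  proof -
    have "(\<Sum>b\<in>B. (g(c := F)) b (\<tau> b x)) = (\<Sum>b\<in>B. g b (\<tau> b x))"
      using insert.hyps by (intro sum.cong) auto
    then have "(\<Sum>b\<in>insert c B. (g(c := F)) b (\<tau> b x)) = F (\<tau> c x) + (\<Sum>b\<in>B. g b (\<tau> b x))"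
      using insert.hyps by simp
    also have "\<dots> = F x" by (simp flip: g(2)[rule_format])
    finally show ?thesis by (rule sym)
  qed
  moreover have "\<forall>b\<in>insert c B. (g(c := F)) b \<in> S" using g(1) insert.prems(1) by simp
  ultimately show ?case by blast
qed simp

text \<open>All periods are integer multiples of \<open>d\<close>, so each coset of d Z is a copy of
  Z on which the commuting retractions act. Such an action translates x by a multiple of
  \<open>d\<close> depending on \<open>\<lfloor>x / d\<rfloor>\<close> only, which is the operation
  allowed by \<open>S_shift\<close>.\<close>

lemma periodic_sums_commensurable:
  fixes d :: real
  assumes B: "finite B" "d > 0" "\<And>c. c \<in> B \<Longrightarrow> \<exists>m::int. m \<noteq> 0 \<and> c = of_int m * d"
    and F: "F \<in> periodic_sums B UNIV" "F \<in> S"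
    and S_diff: "\<And>F G. F \<in> S \<Longrightarrow> G \<in> S \<Longrightarrow> (\<lambda>x. F x - G x) \<in> S"
    and S_shift: "\<And>F \<phi>. F \<in> S \<Longrightarrow> (\<lambda>x. F (x + of_int (\<phi> \<lfloor>x / d\<rfloor>) * d)) \<in> S"
  shows "F \<in> periodic_sums B S"
proof -
  obtain m :: "real \<Rightarrow> int" where m: "\<And>c. c \<in> B \<Longrightarrow> m c \<noteq> 0" "\<And>c. c \<in> B \<Longrightarrow> c = of_int (m c) * d"
    using B(3) by metis
  obtain h where h: "\<And>c. c \<in> B \<Longrightarrow> periodic c (h c)" "\<And>x. F x = (\<Sum>c\<in>B. h c x)"
    using F(1) unfolding periodic_sums_def by auto
  define M where "M = (\<lambda>c. nat \<bar>m c\<bar>) ` B"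
  have "finite M" "0 \<notin> M" using B(1) m(1) by (auto simp: M_def)
  then obtain t where t: "\<And>m k. m \<in> M \<Longrightarrow> int m dvd t m k - k"
    "\<And>m k. m \<in> M \<Longrightarrow> t m (k + int m) = t m k"
    "\<And>m m' k. m \<in> M \<Longrightarrow> m' \<in> M \<Longrightarrow> t m (t m' k) = t m' (t m k)"
    using commuting_retractions by metis
  define s where "s c = t (nat \<bar>m c\<bar>)" for c
  have s_dvd: "m c dvd s c k - k" if "c \<in> B" for c k
    using t(1)[of "nat \<bar>m c\<bar>" k] that by (simp add: s_def M_def)
  have s_per: "s c (k + m c) = s c k" if "c \<in> B" for c k
  proof (cases "m c > 0")
    case True
    then show ?thesis using t(2)[of "nat \<bar>m c\<bar>" k] that unfolding s_def M_def by force
  next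
    case False
    then show ?thesis using t(2)[of "nat \<bar>m c\<bar>" "k + m c"] that unfolding s_def M_def by force
  qed
  have s_comm: "s c (s c' k) = s c' (s c k)" if "c \<in> B" "c' \<in> B" for c c' k
    using t(3) that by (simp add: s_def M_def)
  \<comment> \<open>\<open>\<tau> c\<close> applies the retraction to the integer part of x / d and
    keeps the fractional part. It moves x by a multiple of c, hence leaves \<open>h c\<close>
    unchanged, and it sends x and x + c to the same point, hence makes every composition with it
    c-periodic.\<close>
  define \<tau> where "\<tau> c x = x + of_int (s c \<lfloor>x / d\<rfloor> - \<lfloor>x / d\<rfloor>) * d" for c x
  have fl: "\<lfloor>(x + of_int k * d) / d\<rfloor> = \<lfloor>x / d\<rfloor> + k" for x k
    using B(2) by (simp add: add_divide_distrib)
  have \<tau>\<tau>: "\<tau> c (\<tau> c' x) = x + of_int (s c (s c' \<lfloor>x / d\<rfloor>) - \<lfloor>x / d\<rfloor>) * d" for c c' x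
    unfolding \<tau>_def fl by (simp add: algebra_simps)
  have "\<exists>g. (\<forall>c\<in>B. g c \<in> S) \<and> (\<forall>x. F x = (\<Sum>c\<in>B. g c (\<tau> c x)))"
  proof (rule retraction_decomposition[where h = h])
    show "\<tau> b (\<tau> b' x) = \<tau> b' (\<tau> b x)" if "b \<in> B" "b' \<in> B" for b b' x
      using s_comm[OF that] by (simp add: \<tau>\<tau>)
    show "h c (\<tau> c x) = h c x" if c: "c \<in> B" for c x
    proof -
      obtain l where "s c \<lfloor>x / d\<rfloor> - \<lfloor>x / d\<rfloor> = m c * l" using s_dvd[OF c] by (auto elim: dvdE)
      then have "\<tau> c x = x + of_int l * c" using m(2)[OF c] by (simp add: \<tau>_def)
      then show ?thesis using periodic_of_int[OF h(1)[OF c]] by simp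
    qed
    show "(\<lambda>x. G (\<tau> c x)) \<in> S" if "c \<in> B" "G \<in> S" for c G
      using S_shift[OF that(2), of "\<lambda>k. s c k - k"] by (simp add: \<tau>_def)
  qed (fact B(1) F(2) h(2) S_diff)+
  then obtain g where g: "\<And>c. c \<in> B \<Longrightarrow> g c \<in> S" "\<And>x. F x = (\<Sum>c\<in>B. g c (\<tau> c x))" by blast
  show ?thesis
  proof (rule periodic_sumsI)
    show "F x = (\<Sum>c\<in>B. g c (\<tau> c x))" for x by (rule g(2))
    show "(\<lambda>x. g c (\<tau> c x)) \<in> S" if "c \<in> B" for c
      using S_shift[OF g(1)[OF that], of "\<lambda>k. s c k - k"] by (simp add: \<tau>_def)
    show "periodic c (\<lambda>x. g c (\<tau> c x))" if c: "c \<in> B" for c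
    proof -
      have flc: "\<lfloor>(x + c) / d\<rfloor> = \<lfloor>x / d\<rfloor> + m c" for x
        using fl[of x "m c"] m(2)[OF c] by simp
      have "\<tau> c (x + c) = \<tau> c x" for x
        unfolding \<tau>_def flc s_per[OF c] using m(2)[OF c] by (simp add: algebra_simps)
      then show ?thesis by (simp add: periodic_def)
    qed
  qed
qed

section \<open>Shift polynomials\<close>

text \<open>This is P(T) for the translation T by \<open>e\<close>; products of polynomials act as
  compositions (\<open>shift_act_mult\<close>).\<close>

definition shift_act :: "real \<Rightarrow> int poly \<Rightarrow> (real \<Rightarrow> real) \<Rightarrow> real \<Rightarrow> real" where
  "shift_act e P F x = (\<Sum>k\<le>degree P. of_int (coeff P k) * F (x + real k * e))"

lemma shift_act_bound:
  assumes "degree P \<le> n"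
  shows "shift_act e P F x = (\<Sum>k\<le>n. of_int (coeff P k) * F (x + real k * e))"
  unfolding shift_act_def using assms
  by (intro sum.mono_neutral_left) (auto simp: coeff_eq_0)

lemma shift_act_0 [simp]: "shift_act e 0 F = (\<lambda>x. 0)"
  by (simp add: shift_act_def fun_eq_iff)

lemma shift_act_pCons: "shift_act e (pCons a P) F x = of_int a * F x + shift_act e P F (x + e)"
proof -
  have "shift_act e (pCons a P) F x = (\<Sum>k\<le>Suc (degree P). of_int (coeff (pCons a P) k) * F (x + real k * e))"
    by (intro shift_act_bound degree_pCons_le)
  also have "\<dots> = of_int a * F x + (\<Sum>k\<le>degree P. of_int (coeff P k) * F (x + real (Suc k) * e))"
    by (subst sum.atMost_Suc_shift) simp
  also have "(\<Sum>k\<le>degree P. of_int (coeff P k) * F (x + real (Suc k) * e)) = shift_act e P F (x + e)"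
    by (simp add: shift_act_def algebra_simps)
  finally show ?thesis .
qed

lemma shift_act_add: "shift_act e (P + Q) F x = shift_act e P F x + shift_act e Q F x"
proof -
  define n where "n = max (degree P) (degree Q)"
  have "degree P \<le> n" "degree Q \<le> n" "degree (P + Q) \<le> n"
    by (auto simp: n_def intro: degree_add_le)
  then show ?thesis by (simp add: shift_act_bound algebra_simps sum.distrib)
qed

lemma shift_act_smult: "shift_act e (smult a P) F x = of_int a * shift_act e P F x"
  using degree_smult_le[of a P]
  by (simp add: shift_act_bound[of _ "degree P"] sum_distrib_left mult_ac)

lemma shift_act_minus: "shift_act e (P - Q) F x = shift_act e P F x - shift_act e Q F x"
  using shift_act_add[of e P "smult (-1) Q" F x] by (simp only: shift_act_smult) simp

lemma shift_act_mult: "shift_act e (P * Q) F = shift_act e P (shift_act e Q F)"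
proof (induction P)
  case (pCons a P)
  show ?case
    by (rule ext) (simp add: mult_pCons_left shift_act_add shift_act_smult shift_act_pCons pCons.IH)
qed simp

lemma shift_act_commute: "shift_act e P (shift_act e Q F) = shift_act e Q (shift_act e P F)"
  by (metis shift_act_mult mult.commute)

lemma shift_act_monom: "shift_act e (monom 1 m) F x = F (x + real m * e)"
  by (induction m arbitrary: x) (simp_all add: monom_0 monom_Suc shift_act_pCons algebra_simps)

lemma shift_act_1: "shift_act e 1 F = F"
  using shift_act_monom[of e 0 F] by (auto simp: monom_0 one_pCons)

lemma shift_act_Delta: "shift_act e (monom 1 m - 1) F x = F (x + real m * e) - F x"
  by (simp add: shift_act_minus shift_act_monom shift_act_1)

lemma shift_act_sum_poly: "shift_act e (\<Sum>k\<in>A. P k) F x = (\<Sum>k\<in>A. shift_act e (P k) F x)"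
  by (induction A rule: infinite_finite_induct) (auto simp: shift_act_add)

lemma shift_act_sum: "shift_act e P (\<lambda>x. \<Sum>k\<in>A. F k x) x = (\<Sum>k\<in>A. shift_act e P (F k) x)"
  unfolding shift_act_def by (simp add: sum_distrib_left sum.swap[of _ A])

lemma shift_act_diff: "shift_act e P (\<lambda>x. F x - G x) x = shift_act e P F x - shift_act e P G x"
  unfolding shift_act_def by (simp add: right_diff_distrib sum_subtractf)

lemma shift_act_scale: "shift_act e P (\<lambda>x. a * F x) x = a * shift_act e P F x"
  unfolding shift_act_def by (simp add: sum_distrib_left mult_ac)

lemma shift_act_zero: "shift_act e P (\<lambda>x. 0) = (\<lambda>x. 0)"
  by (simp add: shift_act_def fun_eq_iff)

lemma periodic_shift_act: "periodic c F \<Longrightarrow> periodic c (shift_act e P F)"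
  unfolding periodic_def shift_act_def
  by (auto simp: add.assoc intro!: sum.cong) (metis add.assoc add.commute)

lemma shift_act_Ints: "(\<And>x. F x \<in> \<int>) \<Longrightarrow> shift_act e P F x \<in> \<int>"
  unfolding shift_act_def by (intro Ints_sum Ints_mult) auto

lemma periodic_sums_shift_act:
  assumes "F \<in> periodic_sums B UNIV"
  shows "shift_act e P F \<in> periodic_sums B UNIV"
proof -
  obtain h where "\<And>c. c \<in> B \<Longrightarrow> periodic c (h c)" "F = (\<lambda>x. \<Sum>c\<in>B. h c x)"
    using assms unfolding periodic_sums_def by blast
  then show ?thesis
    by (intro periodic_sumsI[where h = "\<lambda>c. shift_act e P (h c)"]) (auto simp: shift_act_sum periodic_shift_act)
qed

section \<open>Polynomials annihilating the sums over one class\<close>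

lemma monom_minus_1_factor:
  "(monom 1 n - 1) * (\<Sum>k<q. monom 1 (n * k)) = (monom 1 (n * q) - 1 :: int poly)"
proof -
  have "(monom 1 n - 1) * (\<Sum>k<q. monom 1 (n * k)) = (monom 1 n - 1) * (\<Sum>k<q. (monom 1 n :: int poly) ^ k)"
    by (simp add: monom_power)
  also have "\<dots> = monom 1 n ^ q - 1" by (simp add: power_diff_1_eq)
  finally show ?thesis by (simp add: monom_power)
qed

text \<open>The kernel of \<open>T\<^sup>L - 1\<close> is semisimple over \<open>\<real>\<close>: the averages over the subgroups give the projections.\<close>

lemma periodic_sums_average:
  fixes m :: "real \<Rightarrow> nat"
  assumes "finite B" "\<And>c. c \<in> B \<Longrightarrow> m c dvd L \<and> \<bar>c\<bar> = real (m c) * d" "L > 0"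
    "\<And>x. F (x + real L * d) = F x"
    "shift_act d (\<Prod>c\<in>B. monom 1 (m c) - 1) F = (\<lambda>x. 0)"
  shows "F \<in> periodic_sums B UNIV"
  using assms
proof (induction B arbitrary: F)
  case empty
  then show ?case by (auto simp: periodic_sums_def shift_act_1)
next
  case (insert c B)
  define n where "n = m c"
  define q where "q = L div n"
  have n: "n * q = L" "\<bar>c\<bar> = real n * d" using insert.prems(1) by (auto simp: n_def q_def)
  then have q: "q > 0" using \<open>L > 0\<close> by (auto intro: gr0I)
  define Q where "Q = (\<Prod>c\<in>B. monom 1 (m c) - 1 :: int poly)"
  define D where "D = (monom 1 n - 1 :: int poly)"
  define S where "S = (\<Sum>k<q. monom 1 (n * k) :: int poly)"
  have DS: "D * S = monom 1 L - 1"
    using monom_minus_1_factor[of n q] n(1) by (simp add: D_def S_def)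
  have S_avg: "shift_act d S G = (\<lambda>x. real q * G x)" if "shift_act d D G = (\<lambda>x. 0)" for G
  proof
    fix x
    have "periodic \<bar>c\<bar> G"
      using that n(2) by (simp add: fun_eq_iff D_def shift_act_Delta periodic_def)
    from periodic_of_nat[OF this, of x] have "G (x + real (n * k) * d) = G x" for k
      using n(2) by (simp add: algebra_simps)
    then show "shift_act d S G x = real q * G x"
      by (simp add: S_def shift_act_sum_poly shift_act_monom)
  qed
  \<comment> \<open>The mean of F over its q translates by multiples of n d. It is c-periodic
    because (T^n - 1) S = T^L - 1 kills F, and the remainder \<open>F1\<close> is killed by
    S.\<close>
  define A where "A x = shift_act d S F x / real q" for x
  have A_alt: "A = (\<lambda>x. (1 / real q) * shift_act d S F x)" by (simp add: A_def fun_eq_iff)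
  have DA: "shift_act d D A = (\<lambda>x. 0)"
  proof
    fix x
    have "shift_act d D A x = (1 / real q) * shift_act d (D * S) F x"
      unfolding A_alt by (simp only: shift_act_scale shift_act_mult)
    then show "shift_act d D A x = 0" using insert.prems(3) by (simp add: DS shift_act_Delta)
  qed
  then have perA: "periodic \<bar>c\<bar> A"
    using n(2) by (simp add: fun_eq_iff D_def shift_act_Delta periodic_def)
  define F1 where "F1 x = F x - A x" for x
  have F1_alt: "F1 = (\<lambda>x. F x - A x)" by (simp add: F1_def fun_eq_iff)
  have F1L: "F1 (x + real L * d) = F1 x" for x
  proof -
    have "real L * d = real q * \<bar>c\<bar>" unfolding n(2) n(1)[symmetric] by simp
    then show ?thesis
      using periodic_of_nat[OF perA, of x q] insert.prems(3)[of x] by (simp add: F1_def)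
  qed
  have SF1: "shift_act d S F1 = (\<lambda>x. 0)"
    unfolding F1_alt using q by (simp add: fun_eq_iff shift_act_diff S_avg[OF DA]) (simp add: A_def)
  define H where "H = shift_act d Q F1"
  have "shift_act d D H = shift_act d (D * Q) F1" by (simp add: H_def shift_act_mult)
  also have "\<dots> = (\<lambda>x. shift_act d (D * Q) F x - shift_act d (D * Q) A x)"
    unfolding F1_alt by (simp add: fun_eq_iff shift_act_diff)
  also have "shift_act d (D * Q) A = shift_act d Q (shift_act d D A)"
    by (metis mult.commute shift_act_mult)
  also have "D * Q = (\<Prod>c\<in>insert c B. monom 1 (m c) - 1)"
    using insert.hyps by (simp add: D_def Q_def n_def)
  finally have DH: "shift_act d D H = (\<lambda>x. 0)"
    using insert.prems(4) DA by (simp add: shift_act_zero)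
  have "shift_act d S H = (\<lambda>x. 0)"
    unfolding H_def by (subst shift_act_commute) (simp add: SF1 shift_act_zero)
  \<comment> \<open>H is killed by S and also by T^n - 1, on whose kernel S is multiplication by q;
    so q H = 0. Hence the factors of the remaining periods alone annihilate
    \<open>F1\<close>.\<close>
  with S_avg[OF DH] q have "H = (\<lambda>x. 0)" by (auto simp: fun_eq_iff)
  then have "F1 \<in> periodic_sums B UNIV"
    using insert.IH[of F1] insert.prems(1,2) F1L by (simp add: H_def Q_def)
  then obtain h where h: "\<And>c. c \<in> B \<Longrightarrow> periodic c (h c)" "\<And>x. F1 x = (\<Sum>c\<in>B. h c x)"
    unfolding periodic_sums_def by auto
  have "F x = (\<Sum>b\<in>insert c B. (h(c := A)) b x)" for x
  proof -
    have "(\<Sum>b\<in>B. (h(c := A)) b x) = (\<Sum>b\<in>B. h b x)"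
      using insert.hyps by (intro sum.cong) auto
    then show ?thesis using insert.hyps h(2)[of x] by (simp add: F1_def)
  qed
  then show ?case
    using h(1) perA by (intro periodic_sumsI[where h = "h(c := A)"]) (auto simp: periodic_abs)
qed

text \<open>The product of the polynomials x^m - 1 annihilates all the sums, but with two or more
  periods its repeated root 1 makes the kernel too large. Every x^m - 1 still divides the gcd with
  x^L - 1, and the kernel of the gcd consists of functions with period L d. As a divisor of x^L - 1
  the gcd has unit leading and constant coefficients.\<close>

lemma commensurable_annihilator:
  assumes B: "finite B" "\<And>c. c \<in> B \<Longrightarrow> \<exists>m::int. m \<noteq> 0 \<and> c = of_int m * d" and d: "d > 0"
  obtains P where "is_unit (coeff P 0)" "is_unit (lead_coeff P)"
    "\<And>F. shift_act d P F = (\<lambda>x. 0) \<longleftrightarrow> F \<in> periodic_sums B UNIV"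
proof -
  obtain k :: "real \<Rightarrow> int" where k: "\<And>c. c \<in> B \<Longrightarrow> k c \<noteq> 0" "\<And>c. c \<in> B \<Longrightarrow> c = of_int (k c) * d"
    using B(2) by metis
  define m where "m c = nat \<bar>k c\<bar>" for c
  have m: "m c > 0" "\<bar>c\<bar> = real (m c) * d" if "c \<in> B" for c
  proof -
    show "m c > 0" using k(1)[OF that] by (simp add: m_def)
    have "\<bar>c\<bar> = \<bar>of_int (k c) * d\<bar>" using k(2)[OF that] by simp
    then show "\<bar>c\<bar> = real (m c) * d" using d by (simp add: m_def abs_mult)
  qed
  define L where "L = prod m B"
  have L: "L > 0" "\<And>c. c \<in> B \<Longrightarrow> m c dvd L"
    using B(1) m(1) by (auto simp: L_def intro: prod_pos dvd_prodI)
  define D where "D n = (monom 1 n - 1 :: int poly)" for n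
  define P where "P = gcd (D L) (\<Prod>c\<in>B. D (m c))"
  obtain R where R: "D L = P * R" using gcd_dvd1[of "D L"] unfolding P_def dvd_def by blast
  obtain R' where R': "(\<Prod>c\<in>B. D (m c)) = P * R'"
    using gcd_dvd2[of "D L"] unfolding P_def dvd_def by blast
  have "degree (D L) = L"
    using degree_add_eq_left[of "-1" "monom 1 L :: int poly"] L(1) by (simp add: D_def degree_monom_eq)
  then have "lead_coeff (D L) = 1" using L(1) by (simp add: D_def)
  then have "lead_coeff P * lead_coeff R = 1" unfolding R by (simp add: lead_coeff_mult)
  then have u1: "is_unit (lead_coeff P)" by (metis dvd_triv_left)
  have "coeff (D L) 0 = -1" using L(1) by (simp add: D_def)
  then have "coeff P 0 * coeff R 0 = -1" unfolding R by (simp add: coeff_mult)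
  then have u0: "is_unit (coeff P 0)" by (metis dvd_triv_left minus_dvd_iff dvd_minus_iff)
  have D_dvd: "D (m c) dvd P" if c: "c \<in> B" for c
  proof -
    obtain q where "L = m c * q" using L(2)[OF c] unfolding dvd_def by blast
    then have "D (m c) dvd D L"
      unfolding D_def using monom_minus_1_factor[of "m c" q] by (metis dvd_triv_left)
    moreover have "D (m c) dvd (\<Prod>c\<in>B. D (m c))" using B(1) c by (rule dvd_prodI)
    ultimately show ?thesis by (simp add: P_def)
  qed
  show thesis
  proof (rule that[OF u0 u1])
    fix F
    show "shift_act d P F = (\<lambda>x. 0) \<longleftrightarrow> F \<in> periodic_sums B UNIV"
    proof
      assume F: "shift_act d P F = (\<lambda>x. 0)"
      have "shift_act d (D L) F = (\<lambda>x. 0)" "shift_act d (\<Prod>c\<in>B. D (m c)) F = (\<lambda>x. 0)"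
        unfolding R R' by (simp_all add: mult.commute[of P] shift_act_mult F shift_act_zero)
      then show "F \<in> periodic_sums B UNIV"
        using B(1) L m(2) unfolding D_def
        by (intro periodic_sums_average[of B m L d]) (auto simp: fun_eq_iff shift_act_Delta)
    next
      assume "F \<in> periodic_sums B UNIV"
      then obtain h where h: "\<And>c. c \<in> B \<Longrightarrow> periodic c (h c)" "F = (\<lambda>x. \<Sum>c\<in>B. h c x)"
        unfolding periodic_sums_def by blast
      have "shift_act d P (h c) = (\<lambda>x. 0)" if c: "c \<in> B" for c
      proof -
        obtain Q where "P = Q * D (m c)" using D_dvd[OF c] by (metis dvdE mult.commute)
        moreover have "shift_act d (D (m c)) (h c) = (\<lambda>x. 0)"
        proof -
          have "periodic (real (m c) * d) (h c)"
            using h(1)[OF c] m(2)[OF c] periodic_abs[of c] by metis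
          then show ?thesis
            unfolding D_def by (simp add: fun_eq_iff shift_act_Delta periodic_def)
        qed
        ultimately show ?thesis by (simp add: shift_act_mult shift_act_zero)
      qed
      then show "shift_act d P F = (\<lambda>x. 0)" unfolding h(2) by (simp add: fun_eq_iff shift_act_sum)
    qed
  qed
qed

section \<open>Algebraic decomposition\<close>

lemma one_sided_recurrence:
  fixes q w :: "nat \<Rightarrow> int"
  assumes "is_unit (q 0)"
  shows "\<exists>y. \<forall>n. (\<Sum>i\<le>r. q i * (if i \<le> n then y (n - i) else 0)) = w n"
proof -
  obtain u where u: "u * q 0 = 1" using assms by (metis dvdE mult.commute)
  \<comment> \<open>The equations say that the power series with coefficients q and y have the
    product w, and a series with unit constant coefficient is invertible over the integers. The
    conditional in the statement extends y by zero to negative indices.\<close>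
  define A where "A = Abs_fps (\<lambda>i. if i \<le> r then q i else 0)"
  define Y where "Y = Abs_fps w * fps_left_inverse A u"
  have "Y * A = Abs_fps w"
    using fps_left_inverse[of u A] u by (simp add: Y_def A_def mult.assoc)
  then have "(\<Sum>i=0..n. A $ i * Y $ (n - i)) = w n" for n
    by (metis fps_mult_nth fps_nth_Abs_fps mult.commute)
  moreover have "(\<Sum>i=0..n. A $ i * Y $ (n - i)) = (\<Sum>i\<le>r. q i * (if i \<le> n then Y $ (n - i) else 0))" for n
  proof -
    have "(\<Sum>i=0..n. A $ i * Y $ (n - i)) = (\<Sum>i\<in>{i\<in>{..n}. i \<le> r}. q i * Y $ (n - i))"
      unfolding A_def by (subst sum.inter_filter) (auto simp: atLeast0AtMost intro!: sum.cong)
    also have "{i\<in>{..n}. i \<le> r} = {i\<in>{..r}. i \<le> n}" by auto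
    also have "(\<Sum>i\<in>\<dots>. q i * Y $ (n - i)) = (\<Sum>i\<le>r. q i * (if i \<le> n then Y $ (n - i) else 0))"
      by (subst sum.inter_filter) (auto intro!: sum.cong)
    finally show ?thesis .
  qed
  ultimately show ?thesis by (intro exI[of _ "\<lambda>n. Y $ n"]) simp
qed

text \<open>By linearity the right hand side can be split at 0: its part on l \<ge> 0 is solved
  forwards, dividing by the unit \<open>p r\<close>, and its part on l < 0 backwards, dividing by
  the unit \<open>p 0\<close>.\<close>

lemma two_sided_recurrence:
  fixes p :: "nat \<Rightarrow> int" and w :: "int \<Rightarrow> int"
  assumes "is_unit (p 0)" "is_unit (p r)"
  obtains z where "\<And>l. (\<Sum>k\<le>r. p k * z (l + int k)) = w l"
proof -
  have "is_unit ((\<lambda>i. p (r - i)) 0)" using assms by simp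
  then obtain y where y: "\<And>n. (\<Sum>i\<le>r. p (r - i) * (if i \<le> n then y (n - i) else 0)) = w (int n)"
    using one_sided_recurrence[of "\<lambda>i. p (r - i)" r "\<lambda>n. w (int n)"] by auto
  obtain y' where y': "\<And>n. (\<Sum>i\<le>r. p i * (if i \<le> n then y' (n - i) else 0)) = w (-1 - int n)"
    using one_sided_recurrence[of p r "\<lambda>n. w (-1 - int n)"] assms(1) by auto
  \<comment> \<open>The last value in the equation at l is that at l + r. Starting z at r therefore
    makes the sums vanish for l < 0 and brings in \<open>y 0\<close> at l = 0. Likewise z' lives on
    the negative integers and its sums vanish for l \<ge> 0.\<close>
  define z where "z l = (if l \<ge> int r then y (nat (l - int r)) else 0)" for l
  define z' where "z' l = (if l < 0 then y' (nat (-1 - l)) else 0)" for l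
  have z: "(\<Sum>k\<le>r. p k * z (l + int k)) = (if l \<ge> 0 then w l else 0)" for l
  proof (cases "l \<ge> 0")
    case True
    have "(\<Sum>k\<le>r. p k * z (l + int k)) = (\<Sum>i\<le>r. p (r - i) * z (l + int (r - i)))"
      by (rule sum.reindex_bij_witness[of _ "\<lambda>i. r - i" "\<lambda>i. r - i"]) auto
    also have "\<dots> = (\<Sum>i\<le>r. p (r - i) * (if i \<le> nat l then y (nat l - i) else 0))"
    proof (rule sum.cong)
      fix i assume "i \<in> {..r}"
      then have "l + int (r - i) \<ge> int r \<longleftrightarrow> i \<le> nat l" "i \<le> nat l \<Longrightarrow> nat (l + int (r - i) - int r) = nat l - i"
        using True by auto
      then show "p (r - i) * z (l + int (r - i)) = p (r - i) * (if i \<le> nat l then y (nat l - i) else 0)"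
        by (simp add: z_def)
    qed simp
    finally show ?thesis using y[of "nat l"] True by simp
  next
    case False
    then show ?thesis by (auto simp: z_def intro!: sum.neutral)
  qed
  have z': "(\<Sum>k\<le>r. p k * z' (l + int k)) = (if l \<ge> 0 then 0 else w l)" for l
  proof (cases "l \<ge> 0")
    case True
    then show ?thesis by (auto simp: z'_def intro!: sum.neutral)
  next
    case False
    have "(\<Sum>k\<le>r. p k * z' (l + int k)) = (\<Sum>k\<le>r. p k * (if k \<le> nat (-1 - l) then y' (nat (-1 - l) - k) else 0))"
    proof (rule sum.cong)
      fix k
      have "l + int k < 0 \<longleftrightarrow> k \<le> nat (-1 - l)" "k \<le> nat (-1 - l) \<Longrightarrow> nat (-1 - (l + int k)) = nat (-1 - l) - k"
        using False by auto
      then show "p k * z' (l + int k) = p k * (if k \<le> nat (-1 - l) then y' (nat (-1 - l) - k) else 0)"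
        by (simp add: z'_def)
    qed simp
    then show ?thesis using y'[of "nat (-1 - l)"] False by simp
  qed
  have "(\<Sum>k\<le>r. p k * (z (l + int k) + z' (l + int k))) = w l" for l
    using z[of l] z'[of l] by (simp add: distrib_left sum.distrib)
  then show thesis by (rule that)
qed

text \<open>Since e / c is irrational, each coset of c Z + e Z is freely indexed by two integers,
  and a c-periodic function on it depends only on the coefficient of e. The equation thus becomes a
  two-sided recurrence on every coset. Representatives are picked by choice, so nothing is claimed
  about measurability of Z.\<close>

lemma shift_act_surj_periodic:
  assumes P: "is_unit (coeff P 0)" "is_unit (lead_coeff P)"
    and ec: "e / c \<notin> \<rat>" and W: "periodic c W" "\<And>x. W x \<in> \<int>"
  obtains Z where "periodic c Z" "\<And>x. Z x \<in> \<int>" "\<And>x. shift_act e P Z x = W x"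
proof -
  have c: "c \<noteq> 0" using ec by auto
  have indep: "l = 0" if "of_int k * c + of_int l * e = 0" for k l :: int
  proof (rule ccontr)
    assume "l \<noteq> 0"
    then have "e / c = - of_int k / of_int l" using that c by (simp add: field_simps)
    then show False using ec by simp
  qed
  define E where "E x y \<longleftrightarrow> (\<exists>k l :: int. x = y + of_int k * c + of_int l * e)" for x y
  define \<rho> where "\<rho> x = (SOME y. E x y)" for x
  have "E x x" for x unfolding E_def by (intro exI[of _ 0]) simp
  then have E\<rho>: "E x (\<rho> x)" for x unfolding \<rho>_def by (rule someI)
  \<comment> \<open>The coefficient of e relative to the chosen representative of the coset; it is
    unique by \<open>indep\<close>.\<close>
  define l where "l x = (SOME l. \<exists>k :: int. x = \<rho> x + of_int k * c + of_int l * e)" for x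
  have l: "\<exists>k :: int. x = \<rho> x + of_int k * c + of_int (l x) * e" for x
    unfolding l_def by (rule someI_ex) (use E\<rho>[of x] in \<open>unfold E_def, blast\<close>)
  have l_eq: "l x = j" if "x = \<rho> x + of_int k * c + of_int j * e" for x k j
  proof -
    obtain k' :: int where "x = \<rho> x + of_int k' * c + of_int (l x) * e" using l by blast
    with that have "of_int (k' - k) * c + of_int (l x - j) * e = 0"
      unfolding of_int_diff left_diff_distrib by linarith
    then show ?thesis using indep by fastforce
  qed
  have \<rho>_eq: "\<rho> (x + of_int i * c + of_int j * e) = \<rho> x" for x i j
  proof -
    have "E (x + of_int i * c + of_int j * e) y \<longleftrightarrow> E x y" for y
    proof
      assume "E (x + of_int i * c + of_int j * e) y"
      then obtain k l :: int where "x + of_int i * c + of_int j * e = y + of_int k * c + of_int l * e"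
        unfolding E_def by blast
      then have "x = y + of_int (k - i) * c + of_int (l - j) * e" by (simp add: algebra_simps)
      then show "E x y" unfolding E_def by blast
    next
      assume "E x y"
      then obtain k l :: int where "x = y + of_int k * c + of_int l * e" unfolding E_def by blast
      then have "x + of_int i * c + of_int j * e = y + of_int (k + i) * c + of_int (l + j) * e"
        by (simp add: algebra_simps)
      then show "E (x + of_int i * c + of_int j * e) y" unfolding E_def by blast
    qed
    then show ?thesis by (simp add: \<rho>_def)
  qed
  have l_shift: "l (x + of_int i * c + of_int j * e) = l x + j" for x i j
  proof -
    obtain k :: int where "x = \<rho> x + of_int k * c + of_int (l x) * e" using l by blast
    then have "x + of_int i * c + of_int j * e =
        \<rho> (x + of_int i * c + of_int j * e) + of_int (k + i) * c + of_int (l x + j) * e"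
      unfolding \<rho>_eq of_int_add distrib_right by linarith
    then show ?thesis by (rule l_eq)
  qed
  have "\<exists>z. \<forall>j. (\<Sum>k\<le>degree P. coeff P k * z (j + int k)) = \<lfloor>W (y + of_int j * e)\<rfloor>" for y
    by (rule two_sided_recurrence[OF P, of "\<lambda>j. \<lfloor>W (y + of_int j * e)\<rfloor>"]) blast
  then obtain z where z: "\<And>y j. (\<Sum>k\<le>degree P. coeff P k * z y (j + int k)) = \<lfloor>W (y + of_int j * e)\<rfloor>"
    by metis
  define Z where "Z x = real_of_int (z (\<rho> x) (l x))" for x
  have Z1: "periodic c Z"
    using \<rho>_eq[of _ 1 0] l_shift[of _ 1 0] by (simp add: periodic_def Z_def)
  have Z2: "Z x \<in> \<int>" for x by (simp add: Z_def)
  have Z3: "shift_act e P Z x = W x" for x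
  proof -
    have Zk: "Z (x + real k * e) = of_int (z (\<rho> x) (l x + int k))" for k
      using \<rho>_eq[of x 0 "int k"] l_shift[of x 0 "int k"] by (simp add: Z_def)
    have "shift_act e P Z x = of_int (\<Sum>k\<le>degree P. coeff P k * z (\<rho> x) (l x + int k))"
      unfolding shift_act_def Zk by simp
    then have "shift_act e P Z x = W (\<rho> x + of_int (l x) * e)"
      unfolding z using W(2) by simp
    moreover have "W (\<rho> x + of_int (l x) * e) = W x"
    proof -
      obtain k :: int where k: "x = \<rho> x + of_int k * c + of_int (l x) * e" using l by blast
      then have "(\<rho> x + of_int (l x) * e) + of_int k * c = x" by linarith
      from periodic_of_int[OF W(1), of "\<rho> x + of_int (l x) * e" k, unfolded this]
      show ?thesis by (rule sym)
    qed
    ultimately show "shift_act e P Z x = W x" by (rule trans)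
  qed
  show thesis by (rule that[OF Z1 Z2 Z3])
qed

text \<open>The polynomial P annihilating a new class N removes \<open>F N\<close>, and the
  induction hypothesis makes the images of the other classes integer valued. Surjectivity of P(T)
  lifts them, period by period, to integer valued functions H. The total minus the sum of the H is
  integer valued and killed by P(T), so it belongs to N.\<close>

theorem integer_decomposition:
  fixes d :: "real set \<Rightarrow> real"
  assumes "finite \<K>"
    and "\<And>B. B \<in> \<K> \<Longrightarrow> finite B" "\<And>B. B \<in> \<K> \<Longrightarrow> d B > 0"
    and "\<And>B c. B \<in> \<K> \<Longrightarrow> c \<in> B \<Longrightarrow> \<exists>m::int. m \<noteq> 0 \<and> c = of_int m * d B"
    and "\<And>B B'. B \<in> \<K> \<Longrightarrow> B' \<in> \<K> \<Longrightarrow> B \<noteq> B' \<Longrightarrow> d B / d B' \<notin> \<rat>"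
    and "\<And>B. B \<in> \<K> \<Longrightarrow> F B \<in> periodic_sums B UNIV"
    and "\<And>x. (\<Sum>B\<in>\<K>. F B x) \<in> \<int>"
  shows "\<exists>G. (\<forall>B\<in>\<K>. G B \<in> periodic_sums B {G. \<forall>x. G x \<in> \<int>}) \<and>
             (\<forall>x. (\<Sum>B\<in>\<K>. F B x) = (\<Sum>B\<in>\<K>. G B x))"
  using assms
proof (induction \<K> arbitrary: F)
  case (insert N \<K>)
  let ?I = "{G :: real \<Rightarrow> real. \<forall>x. G x \<in> \<int>}"
  obtain P where P: "is_unit (coeff P 0)" "is_unit (lead_coeff P)"
    and ker: "\<And>F. shift_act (d N) P F = (\<lambda>x. 0) \<longleftrightarrow> F \<in> periodic_sums N UNIV"
    using commensurable_annihilator[of N "d N"] insert.prems(1-3) by (metis insertI1)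
  define F' where "F' B = shift_act (d N) P (F B)" for B
  have F'_sum: "shift_act (d N) P (\<lambda>x. \<Sum>B\<in>insert N \<K>. F B x) x = (\<Sum>B\<in>\<K>. F' B x)" for x
  proof -
    have "shift_act (d N) P (F N) = (\<lambda>x. 0)" using ker insert.prems(5) by blast
    then show ?thesis using insert.hyps by (simp only: shift_act_sum F'_def) simp
  qed
  have "\<exists>G. (\<forall>B\<in>\<K>. G B \<in> periodic_sums B ?I) \<and> (\<forall>x. (\<Sum>B\<in>\<K>. F' B x) = (\<Sum>B\<in>\<K>. G B x))"
  proof (rule insert.IH)
    show "F' B \<in> periodic_sums B UNIV" if "B \<in> \<K>" for B
      unfolding F'_def using insert.prems(5)[of B] that by (intro periodic_sums_shift_act) auto
    show "(\<Sum>B\<in>\<K>. F' B x) \<in> \<int>" for x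
      unfolding F'_sum[symmetric] by (intro shift_act_Ints insert.prems(6))
  qed (use insert.prems(1-4) in auto)
  then obtain W where W: "\<And>B. B \<in> \<K> \<Longrightarrow> W B \<in> periodic_sums B ?I"
    "\<And>x. (\<Sum>B\<in>\<K>. F' B x) = (\<Sum>B\<in>\<K>. W B x)" by blast
  have "\<exists>H. H \<in> periodic_sums B ?I \<and> shift_act (d N) P H = W B" if B: "B \<in> \<K>" for B
  proof -
    obtain w where w: "\<And>c. c \<in> B \<Longrightarrow> periodic c (w c)" "\<And>c. c \<in> B \<Longrightarrow> w c \<in> ?I"
        "\<And>x. W B x = (\<Sum>c\<in>B. w c x)"
      by (rule periodic_sumsE[OF W(1)[OF B]], rule that) blast+
    have "\<exists>Z. periodic c Z \<and> (\<forall>x. Z x \<in> \<int>) \<and> (\<forall>x. shift_act (d N) P Z x = w c x)" if c: "c \<in> B" for c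
    proof -
      obtain m :: int where m: "m \<noteq> 0" "c = of_int m * d B" using insert.prems(3)[of B c] B c by auto
      have "d N / d B \<notin> \<rat>" using insert.prems(4)[of N B] insert.hyps B by auto
      moreover have "d N / d B = of_int m * (d N / c)" using m by simp
      ultimately have "d N / c \<notin> \<rat>" by (metis Rats_mult Rats_of_int)
      then show ?thesis
        using shift_act_surj_periodic[OF P _ w(1)[OF c]] w(2)[OF c] by (metis mem_Collect_eq)
    qed
    then obtain Z where Z: "\<And>c. c \<in> B \<Longrightarrow> periodic c (Z c)" "\<And>c x. c \<in> B \<Longrightarrow> Z c x \<in> \<int>"
      "\<And>c x. c \<in> B \<Longrightarrow> shift_act (d N) P (Z c) x = w c x" by metis
    have "(\<lambda>x. \<Sum>c\<in>B. Z c x) \<in> periodic_sums B ?I"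
      using Z by (intro periodic_sumsI[where h = Z]) auto
    moreover have "shift_act (d N) P (\<lambda>x. \<Sum>c\<in>B. Z c x) = W B"
      using Z(3) w(3) by (auto simp: fun_eq_iff shift_act_sum)
    ultimately show ?thesis by blast
  qed
  then obtain H where H: "\<And>B. B \<in> \<K> \<Longrightarrow> H B \<in> periodic_sums B ?I"
    "\<And>B. B \<in> \<K> \<Longrightarrow> shift_act (d N) P (H B) = W B" by metis
  define G where "G x = (\<Sum>B\<in>insert N \<K>. F B x) - (\<Sum>B\<in>\<K>. H B x)" for x
  have H_int: "H B x \<in> \<int>" if B: "B \<in> \<K>" for B x
  proof -
    obtain h where "\<And>c. c \<in> B \<Longrightarrow> h c \<in> ?I" "H B x = (\<Sum>c\<in>B. h c x)"
      by (rule periodic_sumsE[OF H(1)[OF B]]) blast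
    then show ?thesis by (auto intro: Ints_sum)
  qed
  have G_int: "G x \<in> \<int>" for x
    unfolding G_def by (intro Ints_diff insert.prems(6) Ints_sum H_int)
  have "shift_act (d N) P G x = 0" for x
  proof -
    have "shift_act (d N) P G x = (\<Sum>B\<in>\<K>. F' B x) - (\<Sum>B\<in>\<K>. shift_act (d N) P (H B) x)"
      unfolding G_def unfolding shift_act_diff F'_sum by (simp only: shift_act_sum)
    also have "(\<Sum>B\<in>\<K>. shift_act (d N) P (H B) x) = (\<Sum>B\<in>\<K>. W B x)"
      using H(2) by simp
    finally show ?thesis using W(2) by simp
  qed
  then have "G \<in> periodic_sums N UNIV" using ker by blast
  \<comment> \<open>The kernel of P(T) only provides real summands; within one class the retractions
    make them integer valued.\<close>
  then have G: "G \<in> periodic_sums N ?I"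
  proof (rule periodic_sums_commensurable[rotated 3])
    show "\<exists>m::int. m \<noteq> 0 \<and> c = of_int m * d N" if "c \<in> N" for c
      using insert.prems(3) that by blast
  qed (use insert.prems(1,2) G_int in simp_all)
  have "(\<Sum>B\<in>insert N \<K>. F B x) = (\<Sum>B\<in>insert N \<K>. (H(N := G)) B x)" for x
  proof -
    have "(\<Sum>B\<in>\<K>. (H(N := G)) B x) = (\<Sum>B\<in>\<K>. H B x)"
      by (rule sum.cong) (use insert.hyps(2) in auto)
    then have "(\<Sum>B\<in>insert N \<K>. (H(N := G)) B x) = G x + (\<Sum>B\<in>\<K>. H B x)"
      unfolding sum.insert[OF insert.hyps] by simp
    then show ?thesis unfolding G_def by linarith
  qed
  moreover have "(H(N := G)) B \<in> periodic_sums B ?I" if "B \<in> insert N \<K>" for B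
    using H(1)[of B] G that by (cases "B = N") simp_all
  ultimately show ?case by (intro exI[of _ "H(N := G)"] conjI ballI allI)
qed simp

section \<open>Almost everywhere constant functions\<close>

lemma AE_lebesgue_iff_negligible: "(AE x in lebesgue. P x) \<longleftrightarrow> negligible {x :: real. \<not> P x}"
  by (simp add: completion.AE_iff_null_sets negligible_iff_null_sets)

lemma AE_lebesgue_shift:
  assumes "AE x in lebesgue. P x"
  shows "AE x in lebesgue. P (x + s :: real)"
proof -
  have "{x. \<not> P (x + s)} = (+) (-s) ` {x. \<not> P x}"
    by (force simp: image_iff algebra_simps)
  then show ?thesis
    using assms negligible_translation unfolding AE_lebesgue_iff_negligible by metis
qed

lemma borel_measurable_lebesgue_shift:
  assumes "f \<in> borel_measurable lebesgue"
  shows "(\<lambda>x. f (x + s :: real)) \<in> borel_measurable lebesgue"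
proof -
  have "(\<lambda>x::real. x + s) \<in> lebesgue \<rightarrow>\<^sub>M lebesgue"
    using lebesgue_affine_measurable[of "\<lambda>_. 1::real" s] by (simp add: add.commute)
  then show ?thesis using assms by (rule measurable_compose)
qed

lemma bounded_absolutely_integrable:
  fixes f :: "real \<Rightarrow> 'b::euclidean_space"
  assumes "f \<in> borel_measurable lebesgue" "\<And>x. norm (f x) \<le> C"
  shows "f absolutely_integrable_on {l..u}"
proof (rule measurable_bounded_by_integrable_imp_absolutely_integrable[where g = "\<lambda>_. C"])
  show "f \<in> borel_measurable (lebesgue_on {l..u})"
    using assms(1) by (rule measurable_restrict_space1)
qed (use assms(2) in auto)

lemma bounded_integrable:
  fixes f :: "real \<Rightarrow> 'b::euclidean_space"
  assumes "f \<in> borel_measurable lebesgue" "\<And>x. norm (f x) \<le> C"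
  shows "f integrable_on {l..u}"
  using bounded_absolutely_integrable[OF assms] set_lebesgue_integral_eq_integral(1) by blast

lemma integral_0_imp_negligible:
  fixes f :: "real \<Rightarrow> real"
  assumes f: "f \<in> borel_measurable lebesgue" "\<And>x. 0 \<le> f x" "\<And>x. f x \<le> C"
    and 0: "integral {l..u} f = 0"
  shows "negligible ({l..u} \<inter> {x. f x \<noteq> 0})"
proof -
  have ai: "f absolutely_integrable_on {l..u}"
    using f by (intro bounded_absolutely_integrable[where C = C]) auto
  have "(LINT x|lebesgue. indicator {l..u} x *\<^sub>R f x) = 0"
    using set_lebesgue_integral_eq_integral(2)[OF ai] 0 by (simp add: set_lebesgue_integral_def)
  then have "AE x in lebesgue. indicator {l..u} x *\<^sub>R f x = 0"
    using ai f(2) by (subst (asm) integral_nonneg_eq_0_iff_AE) (auto simp: set_integrable_def)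
  then show ?thesis
    unfolding AE_lebesgue_iff_negligible
    by (rule negligible_subset) (auto simp: indicator_def)
qed

text \<open>A density whose integral over every interval is proportional to the length defines a multiple of
  Lebesgue measure, so uniqueness of densities applies.\<close>

lemma AE_const_if_integrals_proportional:
  fixes v :: "real \<Rightarrow> real"
  assumes v: "v \<in> borel_measurable lebesgue" "\<And>x. 1 \<le> v x" "\<And>x. v x \<le> C"
    and I: "\<And>l u. l \<le> u \<Longrightarrow> integral {l..u} v = (u - l) * k"
  shows "AE x in lebesgue. v x = k"
proof -
  have int: "v integrable_on {l..u}" for l u
    using v by (intro bounded_integrable[where C = C]) (auto simp: abs_le_iff order_trans[of _ 1])
  have "1 \<le> integral {0..1} v"
    using integral_le[of "\<lambda>_. 1" "{0..1::real}" v] int v(2) by (simp add: integrable_const_ivl)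
  then have k: "k \<ge> 1" using I[of 0 1] by simp
  \<comment> \<open>Densities over \<open>lborel\<close> need a Borel function, so v is replaced by
    one that agrees with it almost everywhere.\<close>
  obtain v' where v': "v' \<in> borel_measurable borel" "AE x in lborel. v x = v' x"
    using completion_ex_borel_measurable_real[OF v(1)] by auto
  define \<nu> where "\<nu> = density lborel (\<lambda>x. ennreal (v' x / k))"
  have "lborel = \<nu>"
  proof (rule lborel_eqI)
    show "sets \<nu> = sets borel" by (simp add: \<nu>_def)
  next
    fix l u :: real
    assume "\<And>b. b \<in> Basis \<Longrightarrow> l \<bullet> b \<le> u \<bullet> b"
    then have lu: "l \<le> u" by simp
    have "emeasure \<nu> (box l u) = (\<integral>\<^sup>+x. ennreal (v' x / k) * indicator {l<..<u} x \<partial>lborel)"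
      unfolding \<nu>_def using v'(1) by (subst emeasure_density) (auto simp: box_real)
    also have "\<dots> = (\<integral>\<^sup>+x. indicator {l<..<u} x * (v x / k) \<partial>lborel)"
      using v'(2) by (intro nn_integral_cong_AE) (auto elim!: eventually_mono simp: indicator_def)
    also have "\<dots> = u - l"
    proof (rule nn_integral_has_integral_lebesgue)
      show "0 \<le> v x / k" for x using v(2)[of x] k by (intro divide_nonneg_nonneg) linarith+
      have "(v has_integral (u - l) * k) {l..u}"
        using I[OF lu] int by (metis integrable_integral)
      then have "((\<lambda>x. v x / k) has_integral (u - l) * k / k) {l..u}"
        by (rule has_integral_divide)
      then show "((\<lambda>x. v x / k) has_integral u - l) {l<..<u}"
        using k by (simp add: has_integral_Icc_iff_Ioo)
    qed
    finally show "emeasure \<nu> (box l u) = (\<Prod>b\<in>Basis. (u - l) \<bullet> b)" by simp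
  qed
  then have "density lborel (\<lambda>x. ennreal (v' x / k)) = density lborel (\<lambda>x. 1)"
    unfolding \<nu>_def by (simp add: density_1)
  then have "AE x in lborel. ennreal (v' x / k) = 1"
    using v'(1) by (intro sigma_finite_measure.density_unique[OF sigma_finite_lborel]) auto
  with v'(2) have "AE x in lborel. v x = k"
  proof eventually_elim
    case (elim x)
    then have "v' x / k = 1" by (simp add: ennreal_eq_1)
    then show ?case using elim k by simp
  qed
  then show ?thesis by (rule AE_completion)
qed

text \<open>Integrals of v over intervals are invariant under the dense set D of translations and
  depend continuously on the translation, so they are invariant under all of them. As a function of
  the length alone the integral is additive and monotone, hence linear.\<close>

lemma AE_const_if_dense_periods_bounded:
  fixes v :: "real \<Rightarrow> real"
  assumes v: "v \<in> borel_measurable lebesgue" "\<And>x. 1 \<le> v x" "\<And>x. v x \<le> C"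
    and dense: "\<And>t \<epsilon>. \<epsilon> > 0 \<Longrightarrow> \<exists>s\<in>D. \<bar>s - t\<bar> < \<epsilon>"
    and per: "\<And>s. s \<in> D \<Longrightarrow> AE x in lebesgue. v (x + s) = v x"
  shows "\<exists>k. AE x in lebesgue. v x = k"
proof -
  define I where "I l u = integral {l..u} v" for l u
  have int: "v integrable_on {l..u}" for l u
    using v by (intro bounded_integrable[where C = C]) (auto simp: abs_le_iff order_trans[of _ 1])
  have C: "C \<ge> 1" using v(2,3)[of 0] by linarith
  have Icomb: "I l m + I m u = I l u" if "l \<le> m" "m \<le> u" for l m u
    unfolding I_def using that int by (rule Henstock_Kurzweil_Integration.integral_combine)
  have Ib: "0 \<le> I l u" "I l u \<le> C * (u - l)" if "l \<le> u" for l u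
  proof -
    have "0 \<le> v x" for x using v(2)[of x] by linarith
    then show "0 \<le> I l u" unfolding I_def by (intro integral_nonneg int) auto
    have "I l u \<le> integral {l..u} (\<lambda>_. C)" unfolding I_def by (intro integral_le int v) auto
    then show "I l u \<le> C * (u - l)" using that by (simp add: mult.commute)
  qed
  have shiftD: "I (l + s) (u + s) = I l u" if s: "s \<in> D" for l u s
  proof -
    have "I (l + s) (u + s) = integral {l..u} (\<lambda>x. v (x + s))"
      using integral_shift_real_ivl[of "l + s" s "u + s" v] by (simp add: I_def)
    also have "\<dots> = I l u"
      unfolding I_def
      by (rule integral_spike[of "{x. v (x + s) \<noteq> v x}"])
         (use per[OF s] in \<open>auto simp: AE_lebesgue_iff_negligible\<close>)
    finally show ?thesis .
  qed
  \<comment> \<open>Translating an interval by \<delta> exchanges two end pieces of length \<delta>,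
    each with integral between 0 and C * \<delta>.\<close>
  have lip: "\<bar>I (l + \<delta>) (u + \<delta>) - I l u\<bar> \<le> C * \<delta>" if "l \<le> u" "0 \<le> \<delta>" for l u \<delta>
  proof -
    have "I l (l + \<delta>) + I (l + \<delta>) (u + \<delta>) = I l u + I u (u + \<delta>)"
      using that by (subst (1 2) Icomb) auto
    moreover have "0 \<le> I l (l + \<delta>)" "I l (l + \<delta>) \<le> C * \<delta>" "0 \<le> I u (u + \<delta>)" "I u (u + \<delta>) \<le> C * \<delta>"
      using Ib[of l "l + \<delta>"] Ib[of u "u + \<delta>"] that by simp_all
    ultimately show ?thesis by linarith
  qed
  have shift: "I (l + t) (u + t) = I l u" if lu: "l \<le> u" for l u t
  proof (rule ccontr)
    define \<eta> where "\<eta> = \<bar>I (l + t) (u + t) - I l u\<bar>"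
    assume "I (l + t) (u + t) \<noteq> I l u"
    then have "\<eta> > 0" by (simp add: \<eta>_def)
    then obtain s where s: "s \<in> D" "\<bar>s - t\<bar> < \<eta> / C" using dense[of "\<eta> / C" t] C by auto
    have "\<bar>I (l + t) (u + t) - I (l + s) (u + s)\<bar> \<le> C * \<bar>s - t\<bar>"
    proof (cases "s \<le> t")
      case True
      then show ?thesis using lip[of "l + s" "u + s" "t - s"] lu by simp
    next
      case False
      then show ?thesis using lip[of "l + t" "u + t" "s - t"] lu by (simp add: abs_minus_commute)
    qed
    also have "\<dots> < \<eta>" using s(2) C by (simp add: pos_less_divide_eq mult.commute)
    finally show False using shiftD[OF s(1)] by (simp add: \<eta>_def)
  qed
  define \<phi> where "\<phi> h = I 0 h" for h
  have \<phi>: "I l u = \<phi> (u - l)" if "l \<le> u" for l u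
    using shift[of 0 "u - l" l] that by (simp add: \<phi>_def)
  have add: "\<phi> (x + y) = \<phi> x + \<phi> y" if "x \<ge> 0" "y \<ge> 0" for x y
    using Icomb[of 0 x "x + y"] \<phi>[of x "x + y"] that by (simp add: \<phi>_def)
  have mono: "\<phi> x \<le> \<phi> y" if "0 \<le> x" "x \<le> y" for x y
    using Icomb[of 0 x y] Ib(1)[of x y] that by (simp add: \<phi>_def)
  have mult: "\<phi> (real n * x) = real n * \<phi> x" if "x \<ge> 0" for n x
  proof (induction n)
    case 0
    then show ?case by (simp add: \<phi>_def I_def)
  next
    case (Suc n)
    have "\<phi> (real (Suc n) * x) = \<phi> (x + real n * x)" by (simp add: algebra_simps)
    then show ?case using Suc that by (simp add: add algebra_simps)
  qed
  have lin: "\<phi> x = x * \<phi> 1" if x: "x \<ge> 0" for x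
  proof -
    \<comment> \<open>Monotonicity places the value at N x between the values at the integers m and
      m + 1 next to N x, where additivity determines it.\<close>
    have bound: "\<bar>\<phi> x - x * \<phi> 1\<bar> \<le> \<phi> 1 / real N" if N: "N > 0" for N
    proof -
      define m where "m = nat \<lfloor>real N * x\<rfloor>"
      have m: "real m \<le> real N * x" "real N * x \<le> real (Suc m)"
        using x by (auto simp: m_def) linarith
      have "\<phi> (real m * 1) \<le> \<phi> (real N * x)" "\<phi> (real N * x) \<le> \<phi> (real (Suc m) * 1)"
        using m x by (intro mono; simp)+
      then have "real m * \<phi> 1 \<le> real N * \<phi> x" "real N * \<phi> x \<le> real (Suc m) * \<phi> 1"
        using mult x by (metis zero_le_one)+
      moreover have "real m * \<phi> 1 \<le> (real N * x) * \<phi> 1" "(real N * x) * \<phi> 1 \<le> real (Suc m) * \<phi> 1"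
        using m Ib(1)[of 0 1] by (intro mult_right_mono; simp add: \<phi>_def)+
      ultimately have "\<bar>real N * \<phi> x - (real N * x) * \<phi> 1\<bar> \<le> \<phi> 1"
        by (simp add: algebra_simps abs_le_iff)
      also have "real N * \<phi> x - (real N * x) * \<phi> 1 = real N * (\<phi> x - x * \<phi> 1)"
        by (simp add: algebra_simps)
      finally show ?thesis using N by (simp add: abs_mult pos_le_divide_eq mult.commute)
    qed
    have "(\<lambda>N. \<phi> 1 / real N) \<longlonglongrightarrow> 0" by (rule lim_const_over_n)
    then have "\<bar>\<phi> x - x * \<phi> 1\<bar> \<le> 0"
      using bound by (intro tendsto_lowerbound[of _ _ sequentially]) (auto intro: eventually_sequentiallyI[of 1])
    then show ?thesis by simp
  qed
  have "integral {l..u} v = (u - l) * \<phi> 1" if "l \<le> u" for l u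
    using \<phi>[OF that] lin[of "u - l"] that by (simp add: I_def)
  then show ?thesis using AE_const_if_integrals_proportional[OF v] by blast
qed

lemma AE_const_if_dense_periods:
  fixes w :: "real \<Rightarrow> real"
  assumes w: "w \<in> borel_measurable lebesgue"
    and dense: "\<And>t \<epsilon>. \<epsilon> > 0 \<Longrightarrow> \<exists>s\<in>D. \<bar>s - t\<bar> < \<epsilon>"
    and per: "\<And>s. s \<in> D \<Longrightarrow> AE x in lebesgue. w (x + s) = w x"
  shows "\<exists>k. AE x in lebesgue. w x = k"
proof -
  \<comment> \<open>As pi < 4, the values of arctan lie between -2 and 2, so adding 3 gives values
    between 1 and 5. Injectivity of arctan carries the constancy back to w.\<close>
  define v where "v x = arctan (w x) + 3" for x
  have "v \<in> borel_measurable lebesgue"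
    unfolding v_def using w by (intro borel_measurable_add borel_measurable_arctan) auto
  moreover have "1 \<le> v x" "v x \<le> 5" for x
    using arctan_lbound[of "w x"] arctan_ubound[of "w x"] pi_less_4 by (auto simp: v_def)
  moreover have "AE x in lebesgue. v (x + s) = v x" if "s \<in> D" for s
    using per[OF that] by eventually_elim (simp add: v_def)
  ultimately obtain k where "AE x in lebesgue. v x = k"
    using AE_const_if_dense_periods_bounded[of v 5 D] dense by blast
  then have "AE x in lebesgue. w x = tan (k - 3)"
    by eventually_elim (auto simp: v_def tan_arctan)
  then show ?thesis by blast
qed

section \<open>Incommensurable periods and drift\<close>

lemma dense_integer_combinations:
  fixes \<beta> b t :: real
  assumes irr: "\<beta> / b \<notin> \<rat>" and "\<epsilon> > 0"
  shows "\<exists>s\<in>{of_int k * \<beta> + of_int l * b | k l :: int. True}. \<bar>s - t\<bar> < \<epsilon>"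
proof -
  have b: "b \<noteq> 0" using irr by auto
  obtain h k where hk: "\<bar>of_int k * (\<beta> / b) - of_int h - t / b\<bar> < \<epsilon> / \<bar>b\<bar>"
    by (rule sequence_of_fractional_parts_is_dense[OF irr, of "\<epsilon> / \<bar>b\<bar>" "t / b"])
      (use \<open>\<epsilon> > 0\<close> b that in auto)
  have "of_int k * (\<beta> / b) - of_int h - t / b = (of_int k * \<beta> + of_int (-h) * b - t) / b"
    using b by (simp add: field_simps)
  with hk have "\<bar>of_int k * \<beta> + of_int (-h) * b - t\<bar> < \<epsilon>"
    using b by (simp add: abs_divide divide_less_cancel)
  then show ?thesis by blast
qed

lemma integral_periodic_shift:
  fixes \<phi> :: "real \<Rightarrow> real"
  assumes int: "\<And>l u. \<phi> integrable_on {l..u}" and per: "periodic b \<phi>" and b: "b > 0"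
  shows "integral {0..b} (\<lambda>x. \<phi> (x + \<beta>)) = integral {0..b} \<phi>"
proof -
  define k where "k = \<lfloor>\<beta> / b\<rfloor>"
  define r where "r = \<beta> - of_int k * b"
  have r: "0 \<le> r" "r \<le> b"
    using b floor_divide_lower[of b \<beta>] floor_divide_upper[of b \<beta>] by (auto simp: r_def k_def algebra_simps)
  have "\<phi> (x + \<beta>) = \<phi> (x + r)" for x
    using periodic_of_int[OF per, of "x + r" k] by (simp add: r_def)
  then have "integral {0..b} (\<lambda>x. \<phi> (x + \<beta>)) = integral {0..b} (\<lambda>x. \<phi> (x + r))" by simp
  also have "\<dots> = integral {r..b + r} \<phi>"
    using integral_shift_real_ivl[of r r "b + r" \<phi>] by simp
  also have "\<dots> = integral {r..b} \<phi> + integral {b..b + r} \<phi>"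
    using r int by (intro Henstock_Kurzweil_Integration.integral_combine[symmetric]) auto
  also have "integral {b..b + r} \<phi> = integral {0..r} (\<lambda>x. \<phi> (x + b))"
    using integral_shift_real_ivl[of b b "b + r" \<phi>] by (simp add: add.commute)
  also have "\<dots> = integral {0..r} \<phi>" using per by (simp add: periodic_def)
  also have "integral {r..b} \<phi> + integral {0..r} \<phi> = integral {0..b} \<phi>"
    using r int by (subst add.commute, intro Henstock_Kurzweil_Integration.integral_combine) auto
  finally show ?thesis .
qed

text \<open>The bounded periodic function arctan o G has the same integral over a period after any
  translation, so arctan (G + c) and arctan G have equal integrals. Their difference has constant
  sign by monotonicity, so it vanishes almost everywhere, which forces c = 0. Passing to arctan
  provides integrability.\<close>

lemma periodic_no_drift:
  fixes G :: "real \<Rightarrow> real"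
  assumes G: "G \<in> borel_measurable lebesgue" "periodic b G" "b > 0"
    and drift: "AE x in lebesgue. G (x + \<beta>) = G x + c"
  shows "c = 0"
proof -
  define \<phi> where "\<phi> x = arctan (G x)" for x
  define \<psi> where "\<psi> x = \<bar>arctan (G x + c) - arctan (G x)\<bar>" for x
  have meas: "\<phi> \<in> borel_measurable lebesgue" "(\<lambda>x. arctan (G x + c)) \<in> borel_measurable lebesgue"
    using G(1) by (auto simp: \<phi>_def[abs_def] intro!: borel_measurable_arctan borel_measurable_add)
  have arc: "\<bar>arctan y\<bar> \<le> 2" for y
    using arctan_lbound[of y] arctan_ubound[of y] pi_less_4 by (simp add: abs_le_iff)
  have int: "\<phi> integrable_on {l..u}" "(\<lambda>x. arctan (G x + c)) integrable_on {l..u}" for l u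
    using meas arc by (intro bounded_integrable[where C = 2]; simp add: \<phi>_def)+
  have "integral {0..b} (\<lambda>x. arctan (G x + c)) = integral {0..b} (\<lambda>x. \<phi> (x + \<beta>))"
    by (rule integral_spike[of "{x. G (x + \<beta>) \<noteq> G x + c}"])
       (use drift in \<open>auto simp: AE_lebesgue_iff_negligible \<phi>_def\<close>)
  also have "\<dots> = integral {0..b} \<phi>"
    using G(2,3) by (intro integral_periodic_shift[OF int(1)]) (auto simp: periodic_def \<phi>_def)
  finally have eq: "integral {0..b} (\<lambda>x. arctan (G x + c) - \<phi> x) = 0"
    using int by (subst integral_diff) auto
  have "integral {0..b} \<psi> = 0"
  proof (cases "c \<ge> 0")
    case True
    then have "\<psi> = (\<lambda>x. arctan (G x + c) - \<phi> x)"
      by (auto simp: \<psi>_def \<phi>_def fun_eq_iff arctan_le_iff abs_of_nonneg)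
    then show ?thesis using eq by simp
  next
    case False
    then have "\<psi> = (\<lambda>x. - (arctan (G x + c) - \<phi> x))"
      by (auto simp: \<psi>_def \<phi>_def fun_eq_iff arctan_le_iff abs_of_nonpos)
    then show ?thesis using eq by (simp del: minus_diff_eq)
  qed
  have "negligible ({0..b} \<inter> {x. \<psi> x \<noteq> 0})"
  proof (rule integral_0_imp_negligible[where C = 4])
    show "integral {0..b} \<psi> = 0" by fact
    show "\<psi> \<in> borel_measurable lebesgue"
      unfolding \<psi>_def using meas by (intro borel_measurable_abs borel_measurable_diff) (simp_all add: \<phi>_def[abs_def])
    show "\<psi> x \<le> 4" for x
      using arc[of "G x + c"] arc[of "G x"] by (simp add: \<psi>_def)
  qed (simp add: \<psi>_def)
  moreover have "\<not> negligible {0..b}"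
    using G(3) by (simp add: negligible_interval(1)[of 0 b, simplified])
  ultimately show "c = 0"
    by (auto simp: \<psi>_def arctan_eq_iff split: if_splits)
qed

text \<open>The integer combinations of \<beta> and b are almost everywhere periods of G, and they
  are dense because \<beta> / b is irrational.\<close>

lemma AE_const_if_two_periods:
  fixes G :: "real \<Rightarrow> real"
  assumes G: "G \<in> borel_measurable lebesgue" "periodic b G"
    and \<beta>: "AE x in lebesgue. G (x + \<beta>) = G x" "\<beta> / b \<notin> \<rat>"
  shows "\<exists>k. AE x in lebesgue. G x = k"
proof (rule AE_const_if_dense_periods[OF G(1) dense_integer_combinations[OF \<beta>(2)]])
  have nat: "AE x in lebesgue. G (x + real n * \<beta>) = G x" for n
  proof (induction n)
    case (Suc n)
    from AE_lebesgue_shift[OF Suc, of \<beta>] \<beta>(1) show ?case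
      by eventually_elim (simp add: algebra_simps)
  qed simp
  have int: "AE x in lebesgue. G (x + of_int k * \<beta>) = G x" for k
  proof (cases "k \<ge> 0")
    case True
    then show ?thesis using nat[of "nat k"] by simp
  next
    case False
    then show ?thesis using AE_lebesgue_shift[OF nat[of "nat (-k)"], of "of_int k * \<beta>"]
      by (auto elim: eventually_mono)
  qed
  fix s assume "s \<in> {of_int k * \<beta> + of_int l * b | k l :: int. True}"
  then obtain k l :: int where s: "s = of_int k * \<beta> + of_int l * b" by blast
  have "G (x + s) = G (x + of_int k * \<beta>)" for x
    using periodic_of_int[OF G(2), of "x + of_int k * \<beta>" l] by (simp add: s add.assoc)
  then show "AE x in lebesgue. G (x + s) = G x" using int[of k] by simp
qed auto

text \<open>Applying a difference operator removes one summand; by induction the others then only drift,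
  and \<open>periodic_no_drift\<close> excludes that.\<close>

lemma periodic_sum_zero_imp_AE_const:
  fixes G :: "'i \<Rightarrow> real \<Rightarrow> real"
  assumes "finite K" "\<And>i. i \<in> K \<Longrightarrow> b i > 0"
    "\<And>i j. i \<in> K \<Longrightarrow> j \<in> K \<Longrightarrow> i \<noteq> j \<Longrightarrow> b i / b j \<notin> \<rat>"
    "\<And>i. i \<in> K \<Longrightarrow> G i \<in> borel_measurable lebesgue" "\<And>i. i \<in> K \<Longrightarrow> periodic (b i) (G i)"
    "AE x in lebesgue. (\<Sum>i\<in>K. G i x) = 0"
  shows "\<forall>i\<in>K. \<exists>k. AE x in lebesgue. G i x = k"
  using assms
proof (induction K arbitrary: G)
  case (insert n K)
  \<comment> \<open>The difference with step \<open>b n\<close> cancels the summand n and keeps the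
    periods of the others.\<close>
  define G' where "G' i x = G i (x + b n) - G i x" for i x
  have "\<forall>i\<in>K. \<exists>k. AE x in lebesgue. G' i x = k"
  proof (rule insert.IH)
    show "G' i \<in> borel_measurable lebesgue" if "i \<in> K" for i
      unfolding G'_def using insert.prems(3)[of i] that
      by (intro borel_measurable_diff borel_measurable_lebesgue_shift) auto
    show "periodic (b i) (G' i)" if "i \<in> K" for i
      using insert.prems(4)[of i] that unfolding periodic_def G'_def
      by (metis add.assoc add.commute insertCI)
    have G'n: "G' n x = 0" for x using insert.prems(4)[of n] by (simp add: G'_def periodic_def)
    have eq: "(\<Sum>i\<in>insert n K. G i (x + b n)) - (\<Sum>i\<in>insert n K. G i x) = (\<Sum>i\<in>K. G' i x)" for x
      using insert.hyps G'n[of x] unfolding sum_subtractf[symmetric] G'_def by simp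
    from AE_lebesgue_shift[OF insert.prems(5), of "b n"] insert.prems(5)
    show "AE x in lebesgue. (\<Sum>i\<in>K. G' i x) = 0"
      by eventually_elim (simp flip: eq)
  qed (use insert.prems in auto)
  have const: "\<exists>k. AE x in lebesgue. G i x = k" if i: "i \<in> K" for i
  proof -
    obtain k where k: "AE x in lebesgue. G' i x = k"
      using \<open>\<forall>i\<in>K. \<exists>k. AE x in lebesgue. G' i x = k\<close> i by blast
    then have "AE x in lebesgue. G i (x + b n) = G i x + k"
      by eventually_elim (simp add: G'_def)
    moreover from this have "k = 0"
      using insert.prems(1,3,4) i by (intro periodic_no_drift[of "G i" "b i"]) auto
    moreover have "b n / b i \<notin> \<rat>" using insert.prems(2)[of n i] insert.hyps i by auto
    ultimately show ?thesis
      using insert.prems(3,4) i by (intro AE_const_if_two_periods[of "G i" "b i" "b n"]) auto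
  qed
  then obtain k where k: "\<And>i. i \<in> K \<Longrightarrow> AE x in lebesgue. G i x = k i" by metis
  have "AE x in lebesgue. \<forall>i\<in>K. G i x = k i"
    using insert.hyps(1) k by (simp add: AE_finite_all)
  with insert.prems(5) have "AE x in lebesgue. G n x = - (\<Sum>i\<in>K. k i)"
  proof eventually_elim
    case (elim x)
    then have "(\<Sum>i\<in>K. G i x) = (\<Sum>i\<in>K. k i)" by simp
    then show ?case using elim(1) insert.hyps by simp
  qed
  then show ?case using const by blast
qed simp

text \<open>A three epsilon argument: w is approximated in the mean by a continuous function, which
  is uniformly continuous on a compact interval.\<close>

lemma translation_continuous_L1:
  fixes w :: "real \<Rightarrow> complex"
  assumes w: "w \<in> borel_measurable lebesgue" "\<And>x. norm (w x) \<le> 1" and \<epsilon>: "\<epsilon> > 0"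
  obtains \<eta> where "\<eta> > 0"
    "\<And>\<delta>. \<bar>\<delta>\<bar> < \<eta> \<Longrightarrow> integral {l..u} (\<lambda>x. norm (w (x + \<delta>) - w x)) < \<epsilon>"
proof (cases "l \<le> u")
  case False
  then show thesis using that[of 1] \<epsilon> by simp
next
  case lu: True
  have "w measurable_on UNIV" using w(1) by (simp add: measurable_on_iff_borel_measurable)
  then obtain N g where N: "negligible N" and g: "\<And>n. continuous_on UNIV (g n)"
    and lim: "\<And>x. x \<notin> N \<Longrightarrow> (\<lambda>n. g n x) \<longlonglongrightarrow> w x"
    unfolding measurable_on_def by auto
  have gm: "g n \<in> borel_measurable lebesgue" for n
    using borel_measurable_continuous_onI[OF g] by (simp add: measurable_completion)
  \<comment> \<open>The approximants need not be bounded, so the error is cut off at 2 to permit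
    dominated convergence. The value 2 suffices because w itself varies by at most 2.\<close>
  define e where "e n x = min 2 (norm (w x - g n x))" for n x
  have em: "e n \<in> borel_measurable lebesgue" for n
    unfolding e_def using w(1) gm by (intro borel_measurable_min borel_measurable_norm borel_measurable_diff) auto
  have e0: "0 \<le> e n x" "e n x \<le> 2" for n x by (auto simp: e_def)
  have eint: "e n integrable_on {l'..u'}" for n l' u'
    using em e0 by (intro bounded_integrable[where C = 2]) auto
  \<comment> \<open>The margin 1 contains all translates of the interval by |\<delta>| < 1.\<close>
  define J where "J = {l - 1..u + 1}"
  have "(\<lambda>n. integral J (\<lambda>x. if x \<in> N then 0 else e n x)) \<longlonglongrightarrow> integral J (\<lambda>x. 0)"
  proof (rule dominated_convergence(2)[where h = "\<lambda>_. 2"])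
    show "(\<lambda>x. if x \<in> N then 0 else e n x) integrable_on J" for n
      using eint[of n "l - 1" "u + 1"] unfolding J_def
      by (rule integrable_spike[OF _ N]) auto
    show "(\<lambda>n. if x \<in> N then 0 else e n x) \<longlonglongrightarrow> 0" for x
    proof (cases "x \<in> N")
      case False
      have "(\<lambda>n. norm (w x - g n x)) \<longlonglongrightarrow> 0"
        using tendsto_norm[OF tendsto_diff[OF tendsto_const lim[OF False], of "w x"]] by simp
      from tendsto_min[OF tendsto_const this, of 2] show ?thesis using False by (simp add: e_def)
    qed simp
  qed (use e0 in \<open>auto simp: J_def integrable_const_ivl\<close>)
  moreover have "integral J (\<lambda>x. if x \<in> N then 0 else e n x) = integral J (e n)" for n
    by (rule integral_spike[OF N]) auto
  ultimately have "(\<lambda>n. integral J (e n)) \<longlonglongrightarrow> 0" by simp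
  then have "\<forall>\<^sub>F n in sequentially. integral J (e n) < \<epsilon> / 3"
    using \<epsilon> by (intro order_tendstoD(2)) auto
  then obtain n where n: "integral J (e n) < \<epsilon> / 3"
    by (auto simp: eventually_sequentially)
  \<comment> \<open>The summand 1 keeps the denominator positive when l = u.\<close>
  define \<epsilon>' where "\<epsilon>' = \<epsilon> / (3 * (u - l + 1))"
  have \<epsilon>': "\<epsilon>' > 0" using \<epsilon> lu by (simp add: \<epsilon>'_def)
  have "uniformly_continuous_on J (g n)"
    unfolding J_def using g by (intro compact_uniformly_continuous continuous_on_subset[OF g]) auto
  then obtain \<eta>' where \<eta>': "\<eta>' > 0" "\<And>x y. x \<in> J \<Longrightarrow> y \<in> J \<Longrightarrow> dist y x < \<eta>' \<Longrightarrow> dist (g n y) (g n x) < \<epsilon>'"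
    using \<epsilon>' unfolding uniformly_continuous_on_def by metis
  show thesis
  proof (rule that[of "min \<eta>' 1"])
    show "min \<eta>' 1 > 0" using \<eta>'(1) by simp
    fix \<delta> :: real assume \<delta>: "\<bar>\<delta>\<bar> < min \<eta>' 1"
    have wd: "(\<lambda>x. norm (w (x + \<delta>) - w x)) integrable_on {l..u}"
    proof (rule bounded_integrable[where C = 2])
      show "norm (norm (w (x + \<delta>) - w x)) \<le> 2" for x
        using norm_triangle_ineq4[of "w (x + \<delta>)" "w x"] w(2)[of x] w(2)[of "x + \<delta>"] by simp
      have "(\<lambda>x. w (x + \<delta>)) \<in> borel_measurable lebesgue"
        using w(1) by (rule borel_measurable_lebesgue_shift)
      then show "(\<lambda>x. norm (w (x + \<delta>) - w x)) \<in> borel_measurable lebesgue" using w(1) by simp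
    qed
    have ed: "(\<lambda>x. e n (x + \<delta>)) integrable_on {l..u}"
      using em e0 by (intro bounded_integrable[where C = 2] borel_measurable_lebesgue_shift) auto
    have "norm (w (x + \<delta>) - w x) \<le> e n (x + \<delta>) + \<epsilon>' + e n x" if x: "x \<in> {l..u}" for x
    proof -
      have "dist (g n (x + \<delta>)) (g n x) < \<epsilon>'"
        using \<delta> x by (intro \<eta>'(2)) (auto simp: J_def dist_real_def)
      then have "norm (w (x + \<delta>) - w x) \<le> norm (w (x + \<delta>) - g n (x + \<delta>)) + \<epsilon>' + norm (w x - g n x)"
        using norm_triangle_ineq[of "w (x + \<delta>) - g n (x + \<delta>)" "g n (x + \<delta>) - g n x"]
          norm_triangle_ineq4[of "w (x + \<delta>) - g n x" "w x - g n x"]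
        by (simp add: dist_norm)
      \<comment> \<open>If one of the two errors has been cut off, the right hand side is at least 2
        and this bound suffices.\<close>
      moreover have "norm (w (x + \<delta>) - w x) \<le> 2"
        using norm_triangle_ineq4[of "w (x + \<delta>)" "w x"] w(2)[of x] w(2)[of "x + \<delta>"] by simp
      ultimately show ?thesis using \<epsilon>' norm_ge_zero[of "w (x + \<delta>) - g n (x + \<delta>)"] norm_ge_zero[of "w x - g n x"]
        unfolding e_def min_def by (smt (verit))
    qed
    then have "integral {l..u} (\<lambda>x. norm (w (x + \<delta>) - w x)) \<le> integral {l..u} (\<lambda>x. e n (x + \<delta>) + \<epsilon>' + e n x)"
      using wd ed eint by (intro integral_le integrable_add) (auto simp: integrable_const_ivl)
    also have "\<dots> = integral {l..u} (\<lambda>x. e n (x + \<delta>)) + (u - l) * \<epsilon>' + integral {l..u} (e n)"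
      using ed eint lu by (subst integral_add integrable_add; (intro integrable_add)?; simp add: integrable_const_ivl)+
    also have "integral {l..u} (\<lambda>x. e n (x + \<delta>)) = integral {l + \<delta>..u + \<delta>} (e n)"
      using integral_shift_real_ivl[of "l + \<delta>" \<delta> "u + \<delta>" "e n"] by simp
    also have "\<dots> \<le> integral J (e n)"
      using \<delta> eint e0 unfolding J_def by (intro integral_subset_le) auto
    also have "integral {l..u} (e n) \<le> integral J (e n)"
      using eint e0 unfolding J_def by (intro integral_subset_le) auto
    also have "(u - l) * \<epsilon>' < \<epsilon> / 3"
    proof -
      have "(u - l) * \<epsilon>' < (u - l + 1) * \<epsilon>'" using \<epsilon>' by simp
      also have "\<dots> = \<epsilon> / 3" using lu by (simp add: \<epsilon>'_def field_simps)
      finally show ?thesis .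
    qed
    finally show "integral {l..u} (\<lambda>x. norm (w (x + \<delta>) - w x)) < \<epsilon>" using n by linarith
  qed
qed

section \<open>Independent frequencies\<close>

lemma AE_lebesgue_witness:
  fixes P :: "real \<Rightarrow> bool"
  assumes "AE x in lebesgue. P x"
  obtains x where "P x"
  using assms non_negligible_UNIV[where 'a = real] unfolding AE_lebesgue_iff_negligible
  by (metis (mono_tags, lifting) Collect_cong UNIV_def)

lemma cis_2pi_eq_imp_Ints:
  assumes "cis (2 * pi * x) = cis (2 * pi * y)"
  shows "x - y \<in> \<int>"
proof -
  have "cis (2 * pi * (x - y)) = 1"
    using assms by (simp add: right_diff_distrib flip: cis_divide)
  then have "cos (2 * pi * (x - y)) = 1" by (simp add: complex_eq_iff)
  then obtain k :: int where "2 * pi * (x - y) = of_int k * 2 * pi"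
    by (auto simp: cos_one_2pi_int)
  then have "x - y = of_int k" by simp
  then show ?thesis by simp
qed

lemma cis_sum: "cis (\<Sum>i\<in>K. f i) = (\<Prod>i\<in>K. cis (f i))"
  by (induction K rule: infinite_finite_induct) (auto simp flip: cis_mult)

text \<open>Kronecker's theorem carried over to a finite index set by an enumeration. The difference
  of two equal frequencies would be a nontrivial integer relation, so the family is injective and
  its independence passes to the set of values.\<close>

lemma Kronecker_simultaneous:
  fixes \<theta> \<alpha> :: "'i \<Rightarrow> real"
  assumes K: "finite K" and indep: "\<And>r :: 'i \<Rightarrow> int. (\<Sum>i\<in>K. of_int (r i) * \<theta> i) = 0 \<Longrightarrow> \<forall>i\<in>K. r i = 0"
    and \<epsilon>: "\<epsilon> > 0"
  obtains t and h :: "'i \<Rightarrow> int" where "\<And>i. i \<in> K \<Longrightarrow> \<bar>t * \<theta> i - of_int (h i) - \<alpha> i\<bar> < \<epsilon>"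
proof -
  define n where "n = card K"
  obtain e where e: "bij_betw e {..<n} K"
    using ex_bij_betw_nat_finite[OF K] by (auto simp: n_def atLeast0LessThan)
  have inj: "inj_on e {..<n}" and img: "e ` {..<n} = K" using e by (auto simp: bij_betw_def)
  have inj\<theta>: "inj_on \<theta> K"
  proof (rule inj_onI, rule ccontr)
    fix i j assume ij: "i \<in> K" "j \<in> K" "\<theta> i = \<theta> j" "i \<noteq> j"
    define r :: "'i \<Rightarrow> int" where "r k = (if k = i then 1 else if k = j then -1 else 0)" for k
    have "(\<Sum>k\<in>K. of_int (r k) * \<theta> k) = (\<Sum>k\<in>{i, j}. of_int (r k) * \<theta> k)"
      using K ij by (intro sum.mono_neutral_right) (auto simp: r_def)
    also have "\<dots> = 0" using ij by (simp add: r_def)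
    finally have "r i = 0" using indep ij by blast
    then show False by (simp add: r_def)
  qed
  interpret Z: Modules.module "\<lambda>r x. real_of_int r * x"
    by unfold_locales (simp_all add: algebra_simps)
  have "\<not> Z.dependent (\<theta> ` K)"
  proof
    assume "Z.dependent (\<theta> ` K)"
    then obtain u v where u: "v \<in> \<theta> ` K" "u v \<noteq> 0" "(\<Sum>v\<in>\<theta> ` K. of_int (u v) * v) = 0"
      using K by (auto simp: Z.dependent_finite)
    then have "(\<Sum>i\<in>K. of_int ((u \<circ> \<theta>) i) * \<theta> i) = 0"
      using inj\<theta> by (simp add: sum.reindex)
    then show False using indep u by fastforce
  qed
  moreover have "(\<lambda>m. \<theta> (e m)) ` {..<n} = \<theta> ` K" unfolding img[symmetric] by (simp add: image_image)
  ultimately have ind: "Z.independent ((\<lambda>m. \<theta> (e m)) ` {..<n})" by simp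
  have inj': "inj_on (\<lambda>m. \<theta> (e m)) {..<n}"
    using comp_inj_on[OF inj, of \<theta>] inj\<theta> img by (simp add: o_def)
  obtain t h where th: "\<And>m. m < n \<Longrightarrow> \<bar>t * \<theta> (e m) - of_int (h m) - \<alpha> (e m)\<bar> < \<epsilon>"
    using Kronecker_thm_1[OF ind inj' \<epsilon>, of "\<lambda>m. \<alpha> (e m)"] by metis
  show thesis
  proof (rule that[of t "\<lambda>i. h (inv_into {..<n} e i)"])
    fix i assume "i \<in> K"
    then obtain m where "m < n" "i = e m" using img by auto
    then show "\<bar>t * \<theta> i - of_int (h (inv_into {..<n} e i)) - \<alpha> i\<bar> < \<epsilon>"
      using th inj by simp
  qed
qed

text \<open>By Kronecker's theorem there are translations close to a period of every function but one, while the
  remaining function is translated by (almost) any prescribed \<open>s\<close>; hence that one is a.e. \<open>s\<close>-periodic modulo 1.\<close>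

lemma independent_frequencies_imp_AE_const_mod_1:
  fixes F :: "'i \<Rightarrow> real \<Rightarrow> real"
  assumes K: "finite K" and b: "\<And>i. i \<in> K \<Longrightarrow> b i > 0"
    and indep: "\<And>r :: 'i \<Rightarrow> int. (\<Sum>i\<in>K. of_int (r i) * (1 / b i)) = 0 \<Longrightarrow> \<forall>i\<in>K. r i = 0"
    and F: "\<And>i. i \<in> K \<Longrightarrow> F i \<in> borel_measurable lebesgue" "\<And>i. i \<in> K \<Longrightarrow> periodic (b i) (F i)"
    and int: "\<And>x. (\<Sum>i\<in>K. F i x) \<in> \<int>" and j: "j \<in> K"
  shows "\<exists>\<kappa>. AE x in lebesgue. F j x - \<kappa> \<in> \<int>"
proof -
  define u where "u i x = cis (2 * pi * F i x)" for i x
  have um: "u i \<in> borel_measurable lebesgue" if "i \<in> K" for i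
  proof -
    have "continuous_on UNIV (\<lambda>y. cis (2 * pi * y))" by (intro continuous_intros)
    from borel_measurable_continuous_on[OF this F(1)[OF that]] show ?thesis
      by (simp add: u_def[abs_def])
  qed
  have un: "norm (u i x) \<le> 1" for i x by (simp add: u_def)
  have uint: "(\<lambda>x. norm (u i (x + p) - u i (x + q))) integrable_on {l..m}" if "i \<in> K" for i p q l m
  proof (rule bounded_integrable[where C = 2])
    show "norm (norm (u i (x + p) - u i (x + q))) \<le> 2" for x
      using norm_triangle_ineq4[of "u i (x + p)" "u i (x + q)"] un[of i "x + p"] un[of i "x + q"] by simp
    have "(\<lambda>x. u i (x + p)) \<in> borel_measurable lebesgue" "(\<lambda>x. u i (x + q)) \<in> borel_measurable lebesgue"
      using um[OF that] by (intro borel_measurable_lebesgue_shift; simp)+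
    then show "(\<lambda>x. norm (u i (x + p) - u i (x + q))) \<in> borel_measurable lebesgue" by simp
  qed
  have uper: "u i (x + of_int k * b i) = u i x" if "i \<in> K" for i x k
    using periodic_of_int[OF F(2)[OF that]] by (simp add: u_def)
  \<comment> \<open>The sum of the F i is an integer, so the product of the u i is 1; on the unit
    circle the conjugate is the inverse. Hence a translation that almost fixes all the other u i
    almost fixes \<open>u j\<close>.\<close>
  have uprod: "u j x = (\<Prod>i\<in>K - {j}. cnj (u i x))" for x
  proof -
    have "(\<Prod>i\<in>K. u i x) = cis (2 * pi * (\<Sum>i\<in>K. F i x))"
      by (simp add: u_def sum_distrib_left flip: cis_sum)
    then have 1: "u j x * (\<Prod>i\<in>K - {j}. u i x) = 1"
      using int[of x] K j by (simp add: prod.remove)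
    have "(\<Prod>i\<in>K - {j}. u i x) * (\<Prod>i\<in>K - {j}. cnj (u i x)) = (\<Prod>i\<in>K - {j}. u i x * cnj (u i x))"
      by (simp add: prod.distrib)
    also have "\<dots> = 1" by (simp add: u_def cis_cnj cis_mult)
    finally show ?thesis using 1 by (metis mult.assoc mult.right_neutral mult_1)
  qed
  have small: "integral {l..m} (\<lambda>x. norm (u j (x + s) - u j x)) \<le> \<epsilon> * real (card K)"
    if \<epsilon>: "\<epsilon> > 0" for l m s \<epsilon>
  proof -
    \<comment> \<open>Kronecker's theorem will provide one translation t that is close to s modulo
      \<open>b j\<close> and close to 0 modulo every other \<open>b i\<close>.\<close>
    define \<sigma> where "\<sigma> i = (if i = j then s else 0)" for i
    have "\<exists>\<eta>>0. \<forall>\<delta>. \<bar>\<delta>\<bar> < \<eta> \<longrightarrow> integral {l + \<sigma> i..m + \<sigma> i} (\<lambda>x. norm (u i (x + \<delta>) - u i x)) < \<epsilon>" if "i \<in> K" for i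
      using translation_continuous_L1[OF um[OF that] un \<epsilon>, of "l + \<sigma> i" "m + \<sigma> i"] by metis
    then obtain \<eta> where \<eta>: "\<And>i. i \<in> K \<Longrightarrow> \<eta> i > 0"
      "\<And>i \<delta>. i \<in> K \<Longrightarrow> \<bar>\<delta>\<bar> < \<eta> i \<Longrightarrow> integral {l + \<sigma> i..m + \<sigma> i} (\<lambda>x. norm (u i (x + \<delta>) - u i x)) < \<epsilon>"
      by metis
    \<comment> \<open>Kronecker's theorem measures errors in units of the period, so each tolerance
      \<open>\<eta> i\<close> is divided by \<open>b i\<close>.\<close>
    define \<epsilon>' where "\<epsilon>' = Min ((\<lambda>i. \<eta> i / b i) ` K)"
    have \<epsilon>': "\<epsilon>' > 0" unfolding \<epsilon>'_def using K j \<eta>(1) b by (subst Min_gr_iff) auto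
    obtain t h where th: "\<And>i. i \<in> K \<Longrightarrow> \<bar>t * (1 / b i) - of_int (h i) - \<sigma> i / b i\<bar> < \<epsilon>'"
      using Kronecker_simultaneous[where \<theta> = "\<lambda>i. 1 / b i" and \<alpha> = "\<lambda>i. \<sigma> i / b i", OF K indep \<epsilon>']
      by blast
    define \<delta> where "\<delta> i = t - of_int (h i) * b i - \<sigma> i" for i
    have \<delta>: "\<bar>\<delta> i\<bar> < \<eta> i" if i: "i \<in> K" for i
    proof -
      have "t * (1 / b i) - of_int (h i) - \<sigma> i / b i = \<delta> i / b i"
        using b[OF i] by (simp add: \<delta>_def field_simps)
      moreover have "\<epsilon>' \<le> \<eta> i / b i" using K i by (auto simp: \<epsilon>'_def)
      ultimately have "\<bar>\<delta> i / b i\<bar> < \<eta> i / b i" using th[OF i] by linarith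
      then show ?thesis using b[OF i] by (simp add: abs_divide divide_less_cancel)
    qed
    have ut: "u i (x + t) = u i (x + \<sigma> i + \<delta> i)" if "i \<in> K" for i x
      using uper[OF that, of "x + \<sigma> i + \<delta> i" "h i"] by (simp add: \<delta>_def)
    have I: "integral {l..m} (\<lambda>x. norm (u i (x + t) - u i (x + \<sigma> i))) < \<epsilon>" if i: "i \<in> K" for i
    proof -
      have "integral {l..m} (\<lambda>x. norm (u i (x + t) - u i (x + \<sigma> i)))
          = integral {l + \<sigma> i..m + \<sigma> i} (\<lambda>x. norm (u i (x + \<delta> i) - u i x))"
        unfolding ut[OF i]
        using integral_shift_real_ivl[of "l + \<sigma> i" "\<sigma> i" "m + \<sigma> i" "\<lambda>x. norm (u i (x + \<delta> i) - u i x)"] by simp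
      then show ?thesis using \<eta>(2)[OF i \<delta>[OF i]] by simp
    qed
    have "norm (u j (x + s) - u j x) \<le> (\<Sum>i\<in>K. norm (u i (x + t) - u i (x + \<sigma> i)))" for x
    proof -
      \<comment> \<open>The difference of two products of factors of norm at most 1 is bounded by
        the sum of the differences of the factors.\<close>
      have "norm (u j (x + t) - u j x) \<le> (\<Sum>i\<in>K - {j}. norm (cnj (u i (x + t)) - cnj (u i x)))"
        unfolding uprod by (rule norm_prod_diff) (simp_all add: un)
      also have "\<dots> = (\<Sum>i\<in>K - {j}. norm (u i (x + t) - u i (x + \<sigma> i)))"
        by (intro sum.cong) (auto simp: \<sigma>_def simp flip: complex_cnj_diff)
      finally have "norm (u j (x + s) - u j x) \<le>
          norm (u j (x + t) - u j (x + \<sigma> j)) + (\<Sum>i\<in>K - {j}. norm (u i (x + t) - u i (x + \<sigma> i)))"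
        using norm_triangle_ineq4[of "u j (x + t) - u j x" "u j (x + t) - u j (x + s)"]
        by (simp add: \<sigma>_def)
      then show ?thesis using K j by (simp add: sum.remove)
    qed
    then have "integral {l..m} (\<lambda>x. norm (u j (x + s) - u j x)) \<le>
        integral {l..m} (\<lambda>x. \<Sum>i\<in>K. norm (u i (x + t) - u i (x + \<sigma> i)))"
      using uint[OF j, of s 0] uint K by (intro integral_le integrable_sum) auto
    also have "\<dots> = (\<Sum>i\<in>K. integral {l..m} (\<lambda>x. norm (u i (x + t) - u i (x + \<sigma> i))))"
      using uint K by (intro integral_sum) auto
    also have "\<dots> \<le> (\<Sum>i\<in>K. \<epsilon>)" using I by (intro sum_mono less_imp_le) auto
    finally show ?thesis by (simp add: mult.commute)
  qed
  have ushift: "AE x in lebesgue. u j (x + s) = u j x" for s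
  proof -
    have zero: "integral {l..m} (\<lambda>x. norm (u j (x + s) - u j x)) = 0" for l m
    proof (rule antisym)
      show "integral {l..m} (\<lambda>x. norm (u j (x + s) - u j x)) \<le> 0"
      proof (rule field_le_epsilon)
        fix \<epsilon> :: real assume "\<epsilon> > 0"
        moreover have "card K > 0" using K j by (auto simp: card_gt_0_iff)
        ultimately show "integral {l..m} (\<lambda>x. norm (u j (x + s) - u j x)) \<le> 0 + \<epsilon>"
          using small[of "\<epsilon> / card K" l m s] by simp
      qed
      show "0 \<le> integral {l..m} (\<lambda>x. norm (u j (x + s) - u j x))"
        using uint[OF j, of s 0] by (intro integral_nonneg) auto
    qed
    have "negligible ({l..m} \<inter> {x. norm (u j (x + s) - u j x) \<noteq> 0})" for l m
    proof (rule integral_0_imp_negligible[where C = 2])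
      show "norm (u j (x + s) - u j x) \<le> 2" for x
        using norm_triangle_ineq4[of "u j (x + s)" "u j x"] un[of j "x + s"] un[of j x] by simp
      show "(\<lambda>x. norm (u j (x + s) - u j x)) \<in> borel_measurable lebesgue"
        using borel_measurable_lebesgue_shift[OF um[OF j], of s] um[OF j] by simp
    qed (use zero in auto)
    then have "negligible {x. norm (u j (x + s) - u j x) \<noteq> 0}"
      by (subst negligible_on_intervals) (simp add: Int_commute)
    then show ?thesis by (simp add: AE_lebesgue_iff_negligible)
  qed
  have dense: "\<exists>s\<in>UNIV. \<bar>s - t\<bar> < \<epsilon>" if "\<epsilon> > 0" for t \<epsilon> :: real
    using that by (intro bexI[of _ t]) auto
  have "AE x in lebesgue. Re (u j (x + s)) = Re (u j x)" for s
    using ushift[of s] by eventually_elim simp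
  then have "\<exists>k. AE x in lebesgue. Re (u j x) = k"
    using um[OF j] by (intro AE_const_if_dense_periods[where D = UNIV] dense) auto
  then obtain k1 where k1: "AE x in lebesgue. Re (u j x) = k1" ..
  have "AE x in lebesgue. Im (u j (x + s)) = Im (u j x)" for s
    using ushift[of s] by eventually_elim simp
  then have "\<exists>k. AE x in lebesgue. Im (u j x) = k"
    using um[OF j] by (intro AE_const_if_dense_periods[where D = UNIV] dense) auto
  then obtain k2 where k2: "AE x in lebesgue. Im (u j x) = k2" ..
  have k: "AE x in lebesgue. u j x = Complex k1 k2"
    using k1 k2 by eventually_elim (simp add: complex_eq_iff)
  \<comment> \<open>The value of \<open>F j\<close> at one good point serves as the constant, which
    avoids choosing an argument of the complex number.\<close>
  then obtain x0 where "u j x0 = Complex k1 k2" by (rule AE_lebesgue_witness)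
  with k have "AE x in lebesgue. F j x - F j x0 \<in> \<int>"
    by (auto elim!: eventually_mono intro!: cis_2pi_eq_imp_Ints simp: u_def)
  then show ?thesis by blast
qed

section \<open>The equivalence\<close>

lemma periodic_sums_Union:
  assumes \<K>: "finite \<K>" "\<And>B. B \<in> \<K> \<Longrightarrow> finite B" "\<And>B B'. B \<in> \<K> \<Longrightarrow> B' \<in> \<K> \<Longrightarrow> B \<noteq> B' \<Longrightarrow> B \<inter> B' = {}"
    and G: "\<And>B. B \<in> \<K> \<Longrightarrow> G B \<in> periodic_sums B S"
  shows "(\<lambda>x. \<Sum>B\<in>\<K>. G B x) \<in> periodic_sums (\<Union>\<K>) S"
proof -
  have "\<exists>h. (\<forall>c\<in>B. periodic c (h c) \<and> h c \<in> S) \<and> (\<forall>x. G B x = (\<Sum>c\<in>B. h c x))" if "B \<in> \<K>" for B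
    using G[OF that] unfolding periodic_sums_def by fastforce
  then obtain h where h: "\<And>B c. B \<in> \<K> \<Longrightarrow> c \<in> B \<Longrightarrow> periodic c (h B c)"
    "\<And>B c. B \<in> \<K> \<Longrightarrow> c \<in> B \<Longrightarrow> h B c \<in> S" "\<And>B x. B \<in> \<K> \<Longrightarrow> G B x = (\<Sum>c\<in>B. h B c x)"
    by metis
  define cls where "cls c = (THE B. B \<in> \<K> \<and> c \<in> B)" for c
  have cls: "cls c = B" if "B \<in> \<K>" "c \<in> B" for B c
    unfolding cls_def using that \<K>(3) by (intro the_equality) blast+
  show ?thesis
  proof (rule periodic_sumsI[where h = "\<lambda>c. h (cls c) c"])
    fix x
    have "(\<Sum>c\<in>\<Union>\<K>. h (cls c) c x) = (\<Sum>B\<in>\<K>. \<Sum>c\<in>B. h (cls c) c x)"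
      using \<K> by (subst sum.Union_disjoint) auto
    also have "\<dots> = (\<Sum>B\<in>\<K>. G B x)"
      using h(3) cls by (intro sum.cong) auto
    finally show "(\<Sum>B\<in>\<K>. G B x) = (\<Sum>c\<in>\<Union>\<K>. h (cls c) c x)" by simp
  qed (use h(1,2) cls in auto)
qed

text \<open>On each of the countably many level sets of the floor the function is a translate of F.
  This verifies \<open>S_shift\<close> for measurable functions.\<close>

lemma piecewise_shift_measurable:
  fixes d :: real
  assumes "F \<in> borel_measurable lebesgue"
  shows "(\<lambda>x. F (x + of_int (\<phi> \<lfloor>x / d\<rfloor>) * d)) \<in> borel_measurable lebesgue"
proof (rule measurable_compose_countable[where f = "\<lambda>k x. F (x + of_int (\<phi> k) * d)" and g = "\<lambda>x. \<lfloor>x / d\<rfloor>"])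
  have "(\<lambda>x::real. \<lfloor>x / d\<rfloor>) \<in> borel \<rightarrow>\<^sub>M count_space UNIV" by measurable
  then show "(\<lambda>x. \<lfloor>x / d\<rfloor>) \<in> lebesgue \<rightarrow>\<^sub>M count_space UNIV" by (simp add: measurable_completion)
qed (use assms in \<open>auto intro: borel_measurable_lebesgue_shift\<close>)

section \<open>Commensurability classes of a finite set of periods\<close>

locale period_set =
  fixes A :: "real set"
  assumes fin: "finite A" and nz: "0 \<notin> A" and ne: "A \<noteq> {}"
begin

definition classes :: "real set set" where "classes = A // commensurability_rel A"

lemma equiv: "equiv A (commensurability_rel A)"
  using nz by (rule equiv_commensurability_rel)

lemma Union_classes: "\<Union>classes = A"
  unfolding classes_def by (rule Union_quotient[OF equiv])

lemma finite_classes: "finite classes"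
  unfolding classes_def by (rule finite_quotient[OF fin]) (auto simp: commensurability_rel_def)

lemma class_subset: "B \<in> classes \<Longrightarrow> B \<subseteq> A"
  using Union_classes by blast

lemma finite_class: "B \<in> classes \<Longrightarrow> finite B"
  using class_subset fin finite_subset by blast

lemma class_nonempty: "B \<in> classes \<Longrightarrow> B \<noteq> {}"
  unfolding classes_def by (rule in_quotient_imp_non_empty[OF equiv])

lemma classes_disjoint: "B \<in> classes \<Longrightarrow> B' \<in> classes \<Longrightarrow> B \<noteq> B' \<Longrightarrow> B \<inter> B' = {}"
  unfolding classes_def using quotient_disj[OF equiv] by blast

lemma sum_classes: "(\<Sum>c\<in>A. g c) = (\<Sum>B\<in>classes. \<Sum>c\<in>B. g c)"
  using sum.Union_disjoint[of classes g] finite_class classes_disjoint Union_classes by simp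

lemma class_ratio: "B \<in> classes \<Longrightarrow> c \<in> B \<Longrightarrow> c' \<in> B \<Longrightarrow> c / c' \<in> \<rat>"
  using quotient_eq_iff[OF equiv, of B B c c'] unfolding classes_def
  by (auto simp: commensurability_rel_def)

lemma classes_ratio:
  "B \<in> classes \<Longrightarrow> B' \<in> classes \<Longrightarrow> B \<noteq> B' \<Longrightarrow> c \<in> B \<Longrightarrow> c' \<in> B' \<Longrightarrow> c / c' \<notin> \<rat>"
  using quotient_eq_iff[OF equiv, of B B' c c'] class_subset[of B] class_subset[of B'] unfolding classes_def
  by (auto simp: commensurability_rel_def)

lemma real_lcm_class:
  assumes "B \<in> classes"
  shows "real_lcm B > 0" "c \<in> B \<Longrightarrow> \<exists>k::int. k \<noteq> 0 \<and> real_lcm B = of_int k * c"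
proof -
  have "\<exists>!b. b > 0 \<and> (\<Inter>c\<in>B. int_multiples c) = int_multiples b"
    using assms class_subset[OF assms] nz
    by (intro real_lcm_ex1 finite_class class_nonempty class_ratio) auto
  from theI'[OF this] have b: "real_lcm B > 0" "(\<Inter>c\<in>B. int_multiples c) = int_multiples (real_lcm B)"
    by (auto simp: real_lcm_def)
  show "real_lcm B > 0" by (rule b)
  assume c: "c \<in> B"
  have "real_lcm B \<in> int_multiples (real_lcm B)"
    unfolding int_multiples_def by (rule image_eqI[of _ _ 1]) auto
  then have "real_lcm B \<in> int_multiples c" using b(2) c by blast
  then obtain k :: int where "real_lcm B = of_int k * c" unfolding int_multiples_def by blast
  moreover from this have "k \<noteq> 0" using b(1) by auto
  ultimately show "\<exists>k::int. k \<noteq> 0 \<and> real_lcm B = of_int k * c" by blast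
qed

text \<open>The least common multiple divided by the absolute value of the product of all its
  multipliers \<open>k c\<close> is a common divisor of the class.\<close>

lemma class_generator:
  assumes B: "B \<in> classes"
  shows "\<exists>d>0. \<forall>c\<in>B. \<exists>m::int. m \<noteq> 0 \<and> c = of_int m * d"
proof -
  obtain k :: "real \<Rightarrow> int" where k: "\<And>c. c \<in> B \<Longrightarrow> k c \<noteq> 0 \<and> real_lcm B = of_int (k c) * c"
    using real_lcm_class(2)[OF B] by metis
  define M where "M = \<bar>\<Prod>c\<in>B. k c\<bar>"
  have M: "M > 0" using k finite_class[OF B] by (simp add: M_def)
  show ?thesis
  proof (intro exI[of _ "real_lcm B / of_int M"] conjI ballI)
    show "real_lcm B / of_int M > 0" using real_lcm_class(1)[OF B] M by simp
    fix c assume c: "c \<in> B"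
    have "k c dvd M" using finite_class[OF B] c by (simp add: M_def dvd_prodI)
    then obtain q where q: "M = k c * q" by (elim dvdE)
    then have "q \<noteq> 0" using M by auto
    moreover have "c = of_int q * (real_lcm B / of_int M)"
      using k[OF c] \<open>q \<noteq> 0\<close> by (simp add: q)
    ultimately show "\<exists>m::int. m \<noteq> 0 \<and> c = of_int m * (real_lcm B / of_int M)" by blast
  qed
qed

lemma real_lcm_ratio:
  assumes "B \<in> classes" "B' \<in> classes" "B \<noteq> B'"
  shows "real_lcm B / real_lcm B' \<notin> \<rat>"
proof
  assume R: "real_lcm B / real_lcm B' \<in> \<rat>"
  obtain c c' where c: "c \<in> B" "c' \<in> B'" using assms class_nonempty by blast
  obtain k k' :: int where k: "k \<noteq> 0" "real_lcm B = of_int k * c" "k' \<noteq> 0" "real_lcm B' = of_int k' * c'"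
    using real_lcm_class(2) assms c by metis
  have "c / c' = real_lcm B / real_lcm B' * (of_int k' / of_int k)" using k by simp
  then show False using classes_ratio[OF assms c] R by (metis Rats_mult Rats_divide Rats_of_int)
qed

lemma periodic_real_lcm:
  assumes "B \<in> classes" "\<And>c. c \<in> B \<Longrightarrow> periodic c (h c)"
  shows "periodic (real_lcm B) (\<lambda>x. \<Sum>c\<in>B. h c x)"
proof -
  have "h c (x + real_lcm B) = h c x" if c: "c \<in> B" for c x
  proof -
    obtain k :: int where "real_lcm B = of_int k * c" using real_lcm_class(2)[OF assms(1) c] by blast
    then show ?thesis using periodic_of_int[OF assms(2)[OF c]] by simp
  qed
  then show ?thesis by (simp add: periodic_def)
qed

text \<open>E is the union of the translates of E0 by the group generated by A. This group is
  countable, so E is still null.\<close>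

lemma translation_invariant_null_set:
  assumes "negligible E0"
  obtains E where "negligible E" "E0 \<subseteq> E" "\<And>c x. c \<in> A \<Longrightarrow> x + c \<in> E \<longleftrightarrow> x \<in> E"
proof -
  define s where "s k = (\<Sum>c\<in>A. of_int (k c) * c)" for k :: "real \<Rightarrow> int"
  define E where "E = (\<Union>t\<in>range s. (+) t ` E0)"
  \<comment> \<open>Only the coefficients on the finite set A matter, which gives
    countability.\<close>
  have "range s \<subseteq> s ` (A \<rightarrow>\<^sub>E UNIV)"
  proof
    fix t assume "t \<in> range s"
    then obtain k where "t = s k" by blast
    also have "s k = s (restrict k A)" by (simp add: s_def)
    finally show "t \<in> s ` (A \<rightarrow>\<^sub>E UNIV)" by (rule image_eqI[of t s "restrict k A"]) simp
  qed
  then have cnt: "countable (range s)"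
    by (rule countable_subset) (rule countable_image, rule countable_PiE[OF fin], rule countableI_type)
  have E_null: "negligible E" unfolding E_def
  proof (rule negligible_countable_Union)
    show "countable ((\<lambda>t. (+) t ` E0) ` range s)" using cnt by (rule countable_image)
    fix S assume "S \<in> (\<lambda>t. (+) t ` E0) ` range s"
    then show "negligible S"
      by (elim imageE) (simp only: negligible_translation[OF assms])
  qed
  have E0_E: "E0 \<subseteq> E"
  proof -
    have "s (\<lambda>_. 0) = 0" by (simp add: s_def)
    then have "0 \<in> range s" by (metis rangeI)
    moreover have "(+) 0 ` E0 = E0" by simp
    ultimately show ?thesis unfolding E_def by (metis UN_upper)
  qed
  have shift: "x + of_int i * c \<in> E" if c: "c \<in> A" and xE: "x \<in> E" for c x and i :: int
  proof -
    obtain k y where x: "x = s k + y" "y \<in> E0" using xE unfolding E_def by blast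
    have "s (\<lambda>b. k b + (if b = c then i else 0)) = s k + of_int i * c"
    proof -
      have "s (\<lambda>b. k b + (if b = c then i else 0)) = (\<Sum>b\<in>A. of_int (k b) * b + (if b = c then of_int i * c else 0))"
        unfolding s_def by (intro sum.cong) (auto simp: algebra_simps)
      then show ?thesis using fin c by (simp add: s_def sum.distrib sum.delta)
    qed
    then have "x + of_int i * c = s (\<lambda>b. k b + (if b = c then i else 0)) + y" using x by simp
    then show ?thesis using x(2) unfolding E_def by blast
  qed
  have inv: "x + c \<in> E \<longleftrightarrow> x \<in> E" if "c \<in> A" for c x
    using shift[OF that, of x 1] shift[OF that, of "x + c" "-1"] by auto
  show thesis by (rule that[OF E_null E0_E inv])
qed

lemma measurable_integer_decomposition:
  assumes indep: "rat_independent_family (\<lambda>B. 1 / real_lcm B) classes"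
    and F: "F \<in> periodic_sums A (borel_measurable lebesgue)" "\<And>x. F x \<in> \<int>"
  shows "F \<in> periodic_sums A {g \<in> borel_measurable lebesgue. \<forall>x. g x \<in> \<int>}"
proof -
  let ?S = "{g \<in> borel_measurable lebesgue. \<forall>x :: real. g x \<in> (\<int> :: real set)}"
  obtain h where h: "\<And>c. c \<in> A \<Longrightarrow> periodic c (h c)" "\<And>c. c \<in> A \<Longrightarrow> h c \<in> borel_measurable lebesgue"
    "\<And>x. F x = (\<Sum>c\<in>A. h c x)"
    by (rule periodic_sumsE[OF F(1)], rule that) blast+
  define FB where "FB B x = (\<Sum>c\<in>B. h c x)" for B x
  have FB_sum: "(\<Sum>B\<in>classes. FB B x) = F x" for x
    by (simp add: FB_def h(3) sum_classes)
  have FB_meas: "FB B \<in> borel_measurable lebesgue" if "B \<in> classes" for B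
    unfolding FB_def using h(2) class_subset[OF that] by (intro borel_measurable_sum) auto
  have FB_per: "periodic (real_lcm B) (FB B)" if "B \<in> classes" for B
    unfolding FB_def using h(1) class_subset[OF that] by (intro periodic_real_lcm that) auto
  have ind: "\<forall>B\<in>classes. r B = 0" if "(\<Sum>B\<in>classes. of_int (r B) * (1 / real_lcm B)) = 0"
    for r :: "real set \<Rightarrow> int"
  proof -
    have "(\<Sum>B\<in>classes. of_rat (of_int (r B)) * (1 / real_lcm B)) = 0" using that by simp
    then have "\<forall>B\<in>classes. (of_int (r B) :: rat) = 0"
      using indep[unfolded rat_independent_family_iff[OF finite_classes], rule_format,
          of "\<lambda>B. of_int (r B)"] by blast
    then show ?thesis by simp
  qed
  have "\<exists>\<kappa>. AE x in lebesgue. FB B x - \<kappa> \<in> \<int>" if "B \<in> classes" for B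
    by (rule independent_frequencies_imp_AE_const_mod_1[where F = FB, OF finite_classes real_lcm_class(1) ind
          FB_meas FB_per _ that]) (simp_all add: FB_sum F(2))
  then obtain \<kappa>0 where \<kappa>0: "\<And>B. B \<in> classes \<Longrightarrow> AE x in lebesgue. FB B x - \<kappa>0 B \<in> \<int>" by metis
  then have AE0: "AE x in lebesgue. \<forall>B\<in>classes. FB B x - \<kappa>0 B \<in> \<int>"
    using finite_classes by (simp add: AE_finite_all)
  then obtain x0 where "\<forall>B\<in>classes. FB B x0 - \<kappa>0 B \<in> \<int>" by (rule AE_lebesgue_witness)
  then have "(\<Sum>B\<in>classes. FB B x0 - \<kappa>0 B) \<in> \<int>" by (intro Ints_sum) auto
  then have "F x0 - (\<Sum>B\<in>classes. \<kappa>0 B) \<in> \<int>" by (simp add: sum_subtractf FB_sum)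
  from Ints_diff[OF F(2)[of x0] this] have \<kappa>0_sum: "(\<Sum>B\<in>classes. \<kappa>0 B) \<in> \<int>" by simp
  obtain B1 where B1: "B1 \<in> classes" using ne Union_classes by blast
  \<comment> \<open>The constants add up to an integer, so changing one of them by this integer
    makes the sum 0 without affecting integrality. Sum 0 is needed to recover F off E.\<close>
  define \<kappa> where "\<kappa> = \<kappa>0(B1 := \<kappa>0 B1 - (\<Sum>B\<in>classes. \<kappa>0 B))"
  have "(\<Sum>B\<in>classes - {B1}. \<kappa> B) = (\<Sum>B\<in>classes - {B1}. \<kappa>0 B)"
    by (intro sum.cong) (auto simp: \<kappa>_def)
  then have \<kappa>_sum: "(\<Sum>B\<in>classes. \<kappa> B) = 0"
    using sum.remove[OF finite_classes B1, of \<kappa>] sum.remove[OF finite_classes B1, of \<kappa>0]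
    by (simp add: \<kappa>_def)
  have AE1: "AE x in lebesgue. \<forall>B\<in>classes. FB B x - \<kappa> B \<in> \<int>"
    using AE0
  proof eventually_elim
    case (elim x)
    have "FB B1 x - \<kappa> B1 = (FB B1 x - \<kappa>0 B1) + (\<Sum>B\<in>classes. \<kappa>0 B)" by (simp add: \<kappa>_def)
    also have "\<dots> \<in> \<int>" using elim B1 \<kappa>0_sum by (intro Ints_add) auto
    finally have "FB B1 x - \<kappa> B1 \<in> \<int>" .
    moreover have "\<kappa> B = \<kappa>0 B" if "B \<noteq> B1" for B using that by (simp add: \<kappa>_def)
    ultimately show ?case using elim by metis
  qed
  \<comment> \<open>Invariance of E under all periods makes the case distinction on membership in E
    compatible with every periodicity.\<close>
  obtain E where E: "negligible E" "{x. \<not> (\<forall>B\<in>classes. FB B x - \<kappa> B \<in> \<int>)} \<subseteq> E"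
    "\<And>c x. c \<in> A \<Longrightarrow> x + c \<in> E \<longleftrightarrow> x \<in> E"
    by (rule translation_invariant_null_set[OF AE1[unfolded AE_lebesgue_iff_negligible]]) blast
  obtain d where d: "\<And>B. B \<in> classes \<Longrightarrow> d B > 0"
    "\<And>B c. B \<in> classes \<Longrightarrow> c \<in> B \<Longrightarrow> \<exists>m::int. m \<noteq> 0 \<and> c = of_int m * d B"
    using class_generator by metis
  have d_ratio: "d B / d B' \<notin> \<rat>" if BB: "B \<in> classes" "B' \<in> classes" "B \<noteq> B'" for B B'
  proof
    assume R: "d B / d B' \<in> \<rat>"
    obtain c c' where c: "c \<in> B" "c' \<in> B'" using BB class_nonempty by blast
    obtain m m' :: int where m: "c = of_int m * d B" "c' = of_int m' * d B'"
      using d(2) BB c by metis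
    have "c / c' = d B / d B' * (of_int m / of_int m')" unfolding m by (simp add: mult.commute)
    then show False using classes_ratio[OF BB c] R by (metis Rats_mult Rats_divide Rats_of_int)
  qed
  have "\<exists>G. (\<forall>B\<in>classes. G B \<in> periodic_sums B {G. \<forall>x. G x \<in> \<int>}) \<and>
            (\<forall>x. (\<Sum>B\<in>classes. FB B x) = (\<Sum>B\<in>classes. G B x))"
  proof (rule integer_decomposition[where d = d])
    show "FB B \<in> periodic_sums B UNIV" if "B \<in> classes" for B
      using h(1) class_subset[OF that] by (intro periodic_sumsI[where h = h]) (auto simp: FB_def)
    show "(\<Sum>B\<in>classes. FB B x) \<in> \<int>" for x using F(2) FB_sum by simp
  qed (fact finite_classes finite_class d d_ratio)+
  then obtain W where W: "\<And>B. B \<in> classes \<Longrightarrow> W B \<in> periodic_sums B {G. \<forall>x. G x \<in> \<int>}"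
    "\<And>x. F x = (\<Sum>B\<in>classes. W B x)" unfolding FB_sum by blast
  define G where "G B x = (if x \<in> E then W B x else FB B x - \<kappa> B)" for B x
  have "G B \<in> periodic_sums B ?S" if B: "B \<in> classes" for B
  proof (rule periodic_sums_commensurable[where d = "d B"])
    have "\<exists>w. (\<forall>c\<in>B. periodic c (w c) \<and> w c \<in> {G. \<forall>x. G x \<in> \<int>}) \<and> W B = (\<lambda>x. \<Sum>c\<in>B. w c x)"
      using W(1)[OF B] unfolding periodic_sums_def mem_Collect_eq .
    then obtain w where w: "\<forall>c\<in>B. periodic c (w c) \<and> w c \<in> {G. \<forall>x. G x \<in> \<int>}" "W B = (\<lambda>x. \<Sum>c\<in>B. w c x)"
      by (elim exE conjE)
    obtain r where r: "r \<in> B" using class_nonempty[OF B] by blast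
    show "G B \<in> periodic_sums B UNIV"
    \<comment> \<open>Off E the constant of the class is subtracted from the summand of a single
      period r.\<close>
    proof (rule periodic_sumsI[where h = "\<lambda>c x. if x \<in> E then w c x else h c x - (if c = r then \<kappa> B else 0)"])
      show "periodic c (\<lambda>x. if x \<in> E then w c x else h c x - (if c = r then \<kappa> B else 0))" if "c \<in> B" for c
        using w(1) h(1)[of c] E(3)[of c] class_subset[OF B] that by (auto simp: periodic_def)
      show "G B x = (\<Sum>c\<in>B. if x \<in> E then w c x else h c x - (if c = r then \<kappa> B else 0))" for x
        using finite_class[OF B] r by (simp add: G_def w(2) FB_def sum_subtractf)
    qed simp
    \<comment> \<open>W may fail to be measurable, but it enters only on a null set, and Lebesgue
      measure is complete.\<close>
    have "AE x in lebesgue. FB B x - \<kappa> B = G B x"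
      unfolding AE_lebesgue_iff_negligible by (rule negligible_subset[OF E(1)]) (auto simp: G_def)
    then have "G B \<in> borel_measurable lebesgue"
      by (rule borel_measurable_AE[rotated]) (use FB_meas[OF B] in auto)
    moreover have "G B x \<in> \<int>" for x
      using E(2) B w by (auto simp: G_def intro: Ints_sum)
    ultimately show "G B \<in> ?S" by blast
  qed (use B finite_class d piecewise_shift_measurable in auto)
  then have "(\<lambda>x. \<Sum>B\<in>classes. G B x) \<in> periodic_sums (\<Union>classes) ?S"
    using finite_classes finite_class classes_disjoint by (intro periodic_sums_Union) auto
  moreover have "(\<Sum>B\<in>classes. G B x) = F x" for x
    using \<kappa>_sum by (cases "x \<in> E") (simp_all add: G_def W(2) FB_sum sum_subtractf)
  ultimately show ?thesis by (simp add: Union_classes)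
qed

end

lemma common_denominator:
  fixes p :: "'i \<Rightarrow> rat"
  assumes "finite K"
  obtains D :: int and m :: "'i \<Rightarrow> int" where "D > 0" "\<And>i. i \<in> K \<Longrightarrow> p i * of_int D = of_int (m i)"
proof -
  define D where "D = (\<Prod>i\<in>K. snd (quotient_of (p i)))"
  have pos: "snd (quotient_of r) > 0" for r by (rule quotient_of_denom_pos')
  have "\<exists>m. p i * of_int D = of_int m" if i: "i \<in> K" for i
  proof -
    obtain a b where ab: "quotient_of (p i) = (a, b)" by (cases "quotient_of (p i)")
    then have "b dvd D" using i assms by (metis D_def dvd_prodI snd_conv)
    then obtain c where c: "D = b * c" by (elim dvdE)
    have "b > 0" using pos[of "p i"] ab by simp
    then have "p i * of_int D = of_int (a * c)"
      using quotient_of_div[OF ab] by (simp add: c)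
    then show ?thesis by blast
  qed
  then obtain m where m: "\<And>i. i \<in> K \<Longrightarrow> p i * of_int D = of_int (m i)" by metis
  have "D > 0" unfolding D_def using pos by (intro prod_pos) auto
  then show thesis using m by (rule that)
qed

text \<open>Links a family of periods, in which values may repeat, to the set of its values:
  summands of equal period are added up, and conversely one index for each value carries the whole
  summand.\<close>

lemma periodic_sums_reindex:
  fixes a :: "'j \<Rightarrow> real"
  assumes J: "finite J" and S0: "(\<lambda>x. 0) \<in> S" and S_add: "\<And>F G. F \<in> S \<Longrightarrow> G \<in> S \<Longrightarrow> (\<lambda>x. F x + G x) \<in> S"
  shows "F \<in> periodic_sums (a ` J) S \<longleftrightarrow>
    (\<exists>h. (\<forall>j\<in>J. periodic (a j) (h j) \<and> h j \<in> S) \<and> (\<forall>x. F x = (\<Sum>j\<in>J. h j x)))"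
proof
  assume "F \<in> periodic_sums (a ` J) S"
  then have "\<exists>g. (\<forall>c\<in>a ` J. periodic c (g c) \<and> g c \<in> S) \<and> F = (\<lambda>x. \<Sum>c\<in>a ` J. g c x)"
    unfolding periodic_sums_def mem_Collect_eq .
  then obtain g where g: "\<forall>c\<in>a ` J. periodic c (g c) \<and> g c \<in> S" "F = (\<lambda>x. \<Sum>c\<in>a ` J. g c x)"
    by (elim exE conjE)
  \<comment> \<open>R contains one chosen index for each period; the summands at all other indices
    are 0.\<close>
  define R where "R = inv_into J a ` a ` J"
  define h where "h j = (if j \<in> R then g (a j) else (\<lambda>x. 0))" for j
  have "R \<subseteq> J" by (auto simp: R_def intro: inv_into_into)
  have F_sum: "\<forall>x. F x = (\<Sum>j\<in>J. h j x)"
  proof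
    fix x
    have "(\<Sum>j\<in>J. h j x) = (\<Sum>j\<in>R. g (a j) x)"
      using \<open>R \<subseteq> J\<close> J by (intro sum.mono_neutral_cong_right) (auto simp: h_def)
    also have "\<dots> = (\<Sum>c\<in>a ` J. g (a (inv_into J a c)) x)"
      unfolding R_def by (subst sum.reindex[OF inj_on_inv_into]) auto
    also have "\<dots> = F x" unfolding g(2) by (intro sum.cong) (auto simp: f_inv_into_f)
    finally show "F x = (\<Sum>j\<in>J. h j x)" by simp
  qed
  have "\<forall>j\<in>J. periodic (a j) (h j) \<and> h j \<in> S"
    using g(1) S0 by (auto simp: h_def periodic_def)
  with F_sum show "\<exists>h. (\<forall>j\<in>J. periodic (a j) (h j) \<and> h j \<in> S) \<and> (\<forall>x. F x = (\<Sum>j\<in>J. h j x))"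
    by (intro exI[of _ h] conjI)
next
  assume "\<exists>h. (\<forall>j\<in>J. periodic (a j) (h j) \<and> h j \<in> S) \<and> (\<forall>x. F x = (\<Sum>j\<in>J. h j x))"
  then obtain h where h: "\<forall>j\<in>J. periodic (a j) (h j) \<and> h j \<in> S" "\<forall>x. F x = (\<Sum>j\<in>J. h j x)"
    by (elim exE conjE)
  have S_sum: "(\<lambda>x. \<Sum>j\<in>I. h j x) \<in> S" if "I \<subseteq> J" for I
    using finite_subset[OF that J] that
    by (induction I rule: finite_induct) (use h(1) S0 S_add in auto)
  show "F \<in> periodic_sums (a ` J) S"
  proof (rule periodic_sumsI[where h = "\<lambda>c x. \<Sum>j\<in>{j \<in> J. a j = c}. h j x"])
    show "F x = (\<Sum>c\<in>a ` J. \<Sum>j\<in>{j \<in> J. a j = c}. h j x)" for x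
      using h(2) sum.image_gen[OF J, of "\<lambda>j. h j x" a] by simp
    show "periodic c (\<lambda>x. \<Sum>j\<in>{j \<in> J. a j = c}. h j x)" for c
      unfolding periodic_def
    proof
      fix x
      show "(\<Sum>j\<in>{j \<in> J. a j = c}. h j (x + c)) = (\<Sum>j\<in>{j \<in> J. a j = c}. h j x)"
        using h(1) by (intro sum.cong) (auto simp: periodic_def)
    qed
    show "(\<lambda>x. \<Sum>j\<in>{j \<in> J. a j = c}. h j x) \<in> S" for c by (rule S_sum) auto
  qed
qed

section \<open>Necessity of the independence\<close>

context period_set
begin

text \<open>A rational relation between the \<open>1 / real_lcm B\<close> yields an integer relation between the \<open>1 / r B\<close> for
  arbitrary representatives \<open>r B\<close>; the sum of the sawtooth functions with these frequencies is then
  integer valued.\<close>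

lemma integer_decomposition_imp_independent:
  assumes dec: "\<And>F. F \<in> periodic_sums A (borel_measurable lebesgue) \<Longrightarrow> (\<And>x. F x \<in> \<int>) \<Longrightarrow>
      F \<in> periodic_sums A {g \<in> borel_measurable lebesgue. \<forall>x. g x \<in> \<int>}"
  shows "rat_independent_family (\<lambda>B. 1 / real_lcm B) classes"
  unfolding rat_independent_family_iff[OF finite_classes]
proof (intro allI impI ballI, rule ccontr)
  fix q :: "real set \<Rightarrow> rat" and B1
  assume rel: "(\<Sum>B\<in>classes. of_rat (q B) * (1 / real_lcm B)) = 0" and B1: "B1 \<in> classes" "q B1 \<noteq> 0"
  \<comment> \<open>A function with period \<open>r B\<close> can serve as a single summand, since
    \<open>r B\<close> is itself a period in A; the least common multiple need not lie in A.\<close>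
  obtain r where r: "\<And>B. B \<in> classes \<Longrightarrow> r B \<in> B" using class_nonempty by (metis ex_in_conv)
  have "\<exists>k::int. k \<noteq> 0 \<and> real_lcm B = of_int k * r B" if "B \<in> classes" for B
    using real_lcm_class(2)[OF that r[OF that]] .
  then obtain k :: "real set \<Rightarrow> int" where k: "\<And>B. B \<in> classes \<Longrightarrow> k B \<noteq> 0 \<and> real_lcm B = of_int (k B) * r B"
    by metis
  have r0: "r B \<noteq> 0" if "B \<in> classes" for B using k[OF that] real_lcm_class(1)[OF that] by auto
  obtain D m where D: "D > 0" and m: "\<And>B. B \<in> classes \<Longrightarrow> q B / of_int (k B) * of_int D = of_int (m B)"
    by (rule common_denominator[OF finite_classes, of "\<lambda>B. q B / of_int (k B)"]) blast
  have m_real: "of_int (m B) / r B = of_int D * (of_rat (q B) * (1 / real_lcm B))" if "B \<in> classes" for B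
  proof -
    have "real_of_int (m B) = of_rat (q B / of_int (k B) * of_int D)" unfolding m[OF that] by simp
    also have "\<dots> = of_rat (q B) / of_int (k B) * of_int D" by (simp add: of_rat_mult of_rat_divide)
    finally show ?thesis using k[OF that] by simp
  qed
  have m_rel: "(\<Sum>B\<in>classes. of_int (m B) / r B) = 0"
  proof -
    have "(\<Sum>B\<in>classes. of_int (m B) / r B) = (\<Sum>B\<in>classes. of_int D * (of_rat (q B) * (1 / real_lcm B)))"
      using m_real by (rule sum.cong[OF refl])
    then show ?thesis unfolding sum_distrib_left[symmetric] rel by simp
  qed
  have m1: "m B1 \<noteq> 0" using m[OF B1(1)] B1 k D by (metis divide_eq_0_iff mult_eq_0_iff of_int_0_eq_iff less_irrefl)
  define h where "h B x = frac (of_int (m B) / r B * x)" for B x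
  have h_meas: "h B \<in> borel_measurable lebesgue" for B
  proof -
    have "(\<lambda>x::real. of_int (m B) / r B * x - of_int \<lfloor>of_int (m B) / r B * x\<rfloor>) \<in> borel_measurable borel"
      by measurable
    then show ?thesis by (simp add: h_def[abs_def] frac_def measurable_completion)
  qed
  have h_per: "periodic (r B) (h B)" if "B \<in> classes" for B
  proof -
    have "of_int (m B) / r B * (x + r B) = of_int (m B) / r B * x + of_int (m B)" for x
      using r0[OF that] by (simp add: distrib_left)
    then show ?thesis by (simp add: periodic_def h_def frac_def)
  qed
  have h_frac: "of_int (m B) / r B * x - h B x \<in> \<int>" for B x by (simp add: h_def frac_def)
  define F where "F x = (\<Sum>B\<in>classes. h B x)" for x
  have "F x \<in> \<int>" for x
  proof -
    \<comment> \<open>Each sawtooth differs from its linear part by an integer, and the linear parts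
      add up to 0.\<close>
    have "(\<Sum>B\<in>classes. of_int (m B) / r B * x - h B x) \<in> \<int>" by (intro Ints_sum h_frac)
    then have "(\<Sum>B\<in>classes. of_int (m B) / r B) * x - F x \<in> \<int>"
      by (simp add: sum_subtractf F_def sum_distrib_right)
    then show ?thesis by (simp add: m_rel)
  qed
  moreover have "F \<in> periodic_sums A (borel_measurable lebesgue)"
  proof -
    have "h B \<in> periodic_sums B (borel_measurable lebesgue)" if B: "B \<in> classes" for B
    proof (rule periodic_sumsI[where h = "\<lambda>c. if c = r B then h B else (\<lambda>x. 0)"])
      fix x
      have "(\<Sum>c\<in>B. (if c = r B then h B else (\<lambda>x. 0)) x) = (\<Sum>c\<in>B. if c = r B then h B x else 0)"
        by (intro sum.cong) auto
      then show "h B x = (\<Sum>c\<in>B. (if c = r B then h B else (\<lambda>x. 0)) x)"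
        using finite_class[OF B] r[OF B] by simp
    qed (use h_per[OF B] h_meas in \<open>auto simp: periodic_def\<close>)
    then have "(\<lambda>x. \<Sum>B\<in>classes. h B x) \<in> periodic_sums (\<Union>classes) (borel_measurable lebesgue)"
      by (intro periodic_sums_Union finite_classes finite_class classes_disjoint)
    then show ?thesis by (simp add: F_def[abs_def] Union_classes)
  qed
  ultimately have "F \<in> periodic_sums A {g \<in> borel_measurable lebesgue. \<forall>x. g x \<in> \<int>}"
    by (intro dec)
  then have "\<exists>g. (\<forall>c\<in>A. periodic c (g c) \<and> g c \<in> {g \<in> borel_measurable lebesgue. \<forall>x. g x \<in> \<int>})
      \<and> F = (\<lambda>x. \<Sum>c\<in>A. g c x)"
    unfolding periodic_sums_def mem_Collect_eq .
  then obtain g where g: "\<forall>c\<in>A. periodic c (g c) \<and> g c \<in> {g \<in> borel_measurable lebesgue. \<forall>x. g x \<in> \<int>}"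
    "F = (\<lambda>x. \<Sum>c\<in>A. g c x)" by (elim exE conjE)
  \<comment> \<open>Class by class, the difference of the two decompositions of F; these functions
    sum to 0 and have the pairwise incommensurable periods \<open>real_lcm B\<close>.\<close>
  define G where "G B x = h B x - (\<Sum>c\<in>B. g c x)" for B x
  have "\<forall>B\<in>classes. \<exists>k. AE x in lebesgue. G B x = k"
  proof (rule periodic_sum_zero_imp_AE_const[where b = real_lcm])
    show "G B \<in> borel_measurable lebesgue" if "B \<in> classes" for B
      unfolding G_def using g(1) class_subset[OF that] h_meas
      by (intro borel_measurable_diff borel_measurable_sum) auto
    show "periodic (real_lcm B) (G B)" if "B \<in> classes" for B
    proof -
      have "periodic (real_lcm B) (\<lambda>x. \<Sum>c\<in>B. g c x)"
        using g(1) class_subset[OF that] by (intro periodic_real_lcm that) auto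
      moreover have "h B (x + real_lcm B) = h B x" for x
        using periodic_of_int[OF h_per[OF that]] k[OF that] by simp
      ultimately show ?thesis by (simp add: periodic_def G_def)
    qed
    have "(\<Sum>B\<in>classes. G B x) = 0" for x
      using g(2) by (simp add: G_def sum_subtractf F_def fun_eq_iff flip: sum_classes)
    then show "AE x in lebesgue. (\<Sum>B\<in>classes. G B x) = 0" by simp
  qed (fact finite_classes real_lcm_class(1) real_lcm_ratio)+
  then obtain y where y: "AE x in lebesgue. G B1 x = y" using B1(1) by blast
  define \<mu> where "\<mu> = of_int (m B1) / r B1"
  have \<mu>: "\<mu> \<noteq> 0" using m1 r0[OF B1(1)] by (simp add: \<mu>_def)
  \<comment> \<open>If \<open>G B1 x = y\<close>, then \<mu> * x - y is an integer. As \<mu> is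
    nonzero, this holds for countably many x only, so it cannot hold almost everywhere.\<close>
  have "countable (range (\<lambda>j::int. (of_int j + y) / \<mu>))" by simp
  then have "negligible (range (\<lambda>j::int. (of_int j + y) / \<mu>))"
    by (simp add: negligible_iff_null_sets countable_imp_null_set_lborel null_sets_completionI)
  then have "AE x in lebesgue. x \<notin> range (\<lambda>j::int. (of_int j + y) / \<mu>)"
    by (simp add: AE_lebesgue_iff_negligible)
  with y have "AE x in lebesgue. G B1 x = y \<and> x \<notin> range (\<lambda>j::int. (of_int j + y) / \<mu>)"
    by eventually_elim blast
  then show False
  proof (rule AE_lebesgue_witness)
    fix x assume x: "G B1 x = y \<and> x \<notin> range (\<lambda>j::int. (of_int j + y) / \<mu>)"
    have "(\<Sum>c\<in>B1. g c x) \<in> \<int>"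
      using g(1) class_subset[OF B1(1)] by (intro Ints_sum) auto
    then have "(\<mu> * x - h B1 x) + (\<Sum>c\<in>B1. g c x) \<in> \<int>"
      using h_frac[of B1 x] unfolding \<mu>_def by (intro Ints_add)
    then have "\<mu> * x - y \<in> \<int>" using x by (simp add: G_def algebra_simps)
    then obtain j where "\<mu> * x - y = of_int j" by (elim Ints_cases)
    then have "x = (of_int j + y) / \<mu>" using \<mu> by (simp add: field_simps)
    then show False using x by blast
  qed
qed

end

section \<open>Translation into integer valued maps\<close>

lemma periodic_fun_simple_iff: "periodic_fun_simple F c \<longleftrightarrow> (\<forall>x. F (x + c) = F x)"
  by (simp add: periodic_fun_simple_def)

lemma measurable_int_iff_of_int:
  fixes g :: "'a \<Rightarrow> int"
  shows "g \<in> M \<rightarrow>\<^sub>M count_space UNIV \<longleftrightarrow> (\<lambda>x. real_of_int (g x)) \<in> borel_measurable M"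
proof
  assume "g \<in> M \<rightarrow>\<^sub>M count_space UNIV"
  then show "(\<lambda>x. real_of_int (g x)) \<in> borel_measurable M"
    by (rule measurable_compose) simp
next
  assume "(\<lambda>x. real_of_int (g x)) \<in> borel_measurable M"
  from measurable_compose[OF this measurable_real_floor] show "g \<in> M \<rightarrow>\<^sub>M count_space UNIV" by simp
qed

theorem corollary4p3:
  fixes n :: nat and a :: "nat \<Rightarrow> real"
  assumes "n \<ge> 1" and "\<And>j. j \<in> {1..n} \<Longrightarrow> a j \<noteq> 0"
  shows "(\<forall>f :: real \<Rightarrow> int.
            (\<exists>h :: nat \<Rightarrow> real \<Rightarrow> real.
               (\<forall>j\<in>{1..n}. periodic_fun_simple (h j) (a j) \<and> h j \<in> borel_measurable lebesgue) \<and>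
               (\<forall>x. of_int (f x) = (\<Sum>j=1..n. h j x))) \<longrightarrow>
            (\<exists>g :: nat \<Rightarrow> real \<Rightarrow> int.
               (\<forall>j\<in>{1..n}. periodic_fun_simple (g j) (a j) \<and>
                  g j \<in> measurable lebesgue (count_space UNIV)) \<and>
               (\<forall>x. f x = (\<Sum>j=1..n. g j x))))
         \<longleftrightarrow>
         rat_independent_family (\<lambda>B. 1 / real_lcm B)
           ((a ` {1..n}) // commensurability_rel (a ` {1..n}))"
proof -
  let ?A = "a ` {1..n}"
  let ?S = "{g \<in> borel_measurable lebesgue. \<forall>x :: real. g x \<in> (\<int> :: real set)}"
  interpret period_set ?A
    using assms by unfold_locales (auto simp: image_iff)
  \<comment> \<open>Both kinds of decomposition become membership in \<open>periodic_sums\<close>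
    over the set of periods, where repetitions among the a j have been merged.\<close>
  have real_dec: "(\<exists>h :: nat \<Rightarrow> real \<Rightarrow> real. (\<forall>j\<in>{1..n}. periodic_fun_simple (h j) (a j) \<and> h j \<in> borel_measurable lebesgue) \<and>
       (\<forall>x. of_int (f x) = (\<Sum>j=1..n. h j x))) \<longleftrightarrow>
     (\<lambda>x. of_int (f x)) \<in> periodic_sums ?A (borel_measurable lebesgue)" for f :: "real \<Rightarrow> int"
    by (subst periodic_sums_reindex) (auto simp: periodic_fun_simple_iff periodic_def)
  have int_dec: "(\<exists>g. (\<forall>j\<in>{1..n}. periodic_fun_simple (g j) (a j) \<and>
        g j \<in> measurable lebesgue (count_space UNIV)) \<and> (\<forall>x. f x = (\<Sum>j=1..n. g j x))) \<longleftrightarrow>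
     (\<lambda>x. of_int (f x)) \<in> periodic_sums ?A ?S" (is "?L \<longleftrightarrow> ?R") for f :: "real \<Rightarrow> int"
  proof -
    have "?R \<longleftrightarrow> (\<exists>h. (\<forall>j\<in>{1..n}. periodic (a j) (h j) \<and> h j \<in> ?S) \<and> (\<forall>x. of_int (f x) = (\<Sum>j=1..n. h j x)))"
      by (rule periodic_sums_reindex) auto
    also have "\<dots> \<longleftrightarrow> ?L"
    proof
      assume ?L
      then obtain g where g: "\<forall>j\<in>{1..n}. periodic_fun_simple (g j) (a j) \<and> g j \<in> measurable lebesgue (count_space UNIV)"
        "\<forall>x. f x = (\<Sum>j=1..n. g j x)" by (elim exE conjE)
      then show "\<exists>h. (\<forall>j\<in>{1..n}. periodic (a j) (h j) \<and> h j \<in> ?S) \<and> (\<forall>x. of_int (f x) = (\<Sum>j=1..n. h j x))"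
        by (intro exI[of _ "\<lambda>j x. of_int (g j x)"])
          (auto simp: periodic_fun_simple_iff periodic_def measurable_int_iff_of_int)
    next
      assume "\<exists>h. (\<forall>j\<in>{1..n}. periodic (a j) (h j) \<and> h j \<in> ?S) \<and> (\<forall>x. of_int (f x) = (\<Sum>j=1..n. h j x))"
      then obtain h where h: "\<forall>j\<in>{1..n}. periodic (a j) (h j) \<and> h j \<in> ?S" "\<forall>x. of_int (f x) = (\<Sum>j=1..n. h j x)"
        by (elim exE conjE)
      \<comment> \<open>The summands are real functions with integer values; the floor turns them
        into maps into the integers without changing their values.\<close>
      have fl: "real_of_int \<lfloor>h j x\<rfloor> = h j x" if "j \<in> {1..n}" for j x
        using h(1) that by simp
      show ?L
      proof (intro exI[of _ "\<lambda>j x. \<lfloor>h j x\<rfloor>"] conjI ballI allI)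
        show "periodic_fun_simple (\<lambda>x. \<lfloor>h j x\<rfloor>) (a j)" if "j \<in> {1..n}" for j
          using h(1) that by (simp add: periodic_fun_simple_iff periodic_def)
        show "(\<lambda>x. \<lfloor>h j x\<rfloor>) \<in> measurable lebesgue (count_space UNIV)" if "j \<in> {1..n}" for j
          using h(1) that by (simp add: measurable_int_iff_of_int fl)
        fix x
        have "real_of_int (f x) = real_of_int (\<Sum>j=1..n. \<lfloor>h j x\<rfloor>)"
        proof -
          have "(\<Sum>j=1..n. h j x) = (\<Sum>j=1..n. real_of_int \<lfloor>h j x\<rfloor>)"
            by (rule sum.cong[OF refl]) (rule fl[symmetric])
          then show ?thesis using h(2) by simp
        qed
        then show "f x = (\<Sum>j=1..n. \<lfloor>h j x\<rfloor>)" by (simp only: of_int_eq_iff)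
      qed
    qed
    finally show ?thesis by (rule sym)
  qed
  have "(\<forall>f :: real \<Rightarrow> int. (\<lambda>x. of_int (f x)) \<in> periodic_sums ?A (borel_measurable lebesgue) \<longrightarrow>
      (\<lambda>x. of_int (f x)) \<in> periodic_sums ?A ?S) \<longleftrightarrow> rat_independent_family (\<lambda>B. 1 / real_lcm B) classes"
  proof
    assume *: "\<forall>f :: real \<Rightarrow> int. (\<lambda>x. of_int (f x)) \<in> periodic_sums ?A (borel_measurable lebesgue) \<longrightarrow>
      (\<lambda>x. of_int (f x)) \<in> periodic_sums ?A ?S"
    show "rat_independent_family (\<lambda>B. 1 / real_lcm B) classes"
    proof (rule integer_decomposition_imp_independent)
      fix F assume F: "F \<in> periodic_sums ?A (borel_measurable lebesgue)" "\<And>x. F x \<in> \<int>"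
      have "(\<lambda>x. real_of_int \<lfloor>F x\<rfloor>) = F" using F(2) by (simp add: fun_eq_iff)
      then show "F \<in> periodic_sums ?A ?S" using *[rule_format, of "\<lambda>x. \<lfloor>F x\<rfloor>"] F(1) by simp
    qed
  next
    assume ind: "rat_independent_family (\<lambda>B. 1 / real_lcm B) classes"
    show "\<forall>f :: real \<Rightarrow> int. (\<lambda>x. of_int (f x)) \<in> periodic_sums ?A (borel_measurable lebesgue) \<longrightarrow>
      (\<lambda>x. of_int (f x)) \<in> periodic_sums ?A ?S"
      by (intro allI impI measurable_integer_decomposition[OF ind]) simp_all
  qed
  then show ?thesis unfolding real_dec int_dec by (simp only: classes_def)
qed

end
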